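(* Let $D_n$ denote the age of a uniformly random Catalan--Stanley tree of size $n$. As $n\to\infty$, for $r\in\mathbb{Z}_{\ge1}$, \begin{multline*} \mathbb{P}(D_n=r) = \Big(\frac{4(4^{r}(3r-1)+1)}{(4^{r}+2)^{2}} - \frac{4(4^{r+1}(3r+2)+1)}{(4^{r+1}+2)^{2}}\Big)\\ - \Big(\frac{6\cdot 64^{r}(2r^{3}-5r^{2}+4r-1) - 6\cdot 16^{r}(16r^{3}-24r^{2}+10r-1) + 24\cdot 4^{r}(2r^{3}-r^{2})}{(4^{r}+2)^{4}}\\ - \frac{6\cdot 64^{r+1}(2r^{3}+r^{2}) - 6\cdot 16^{r+1}(16r^{3}+24r^{2}+10r+1) + 24\cdot 4^{r+1}(2r^{3}+5r^{2}+4r+1)}{(4^{r+1}+2)^{4}}\Big)n^{-1}\\ + O\Big(\frac{r^{5}}{3^{r}}n^{-2}\Big), \end{multline*} where the $O$-term holds uniformly in $r$. Moreover, with \begin{align*} c_0 &= \sum_{r\ge1}\frac{4^{r+1}(3r-1)+4}{(4^{r}+2)^{2}} = 2.71825364286795285266\ldots,\\ c_1 &= -\sum_{r\ge1}\frac{6\cdot64^{r}(2r^{3}-5r^{2}+4r-1) - 6\cdot16^{r}(16r^{3}-24r^{2}+10r-1) + 24\cdot4^{r}(2r-1)r^{2}}{(4^{r}+2)^{4}} = -4.22209715101588408238\ldots,\\ c_2 &= \sum_{r\ge1}(2r-1)\frac{4^{r+1}(3r-1)+4}{(4^{r}+2)^{2}} - c_0^{2} = 0.91845604214374797357\ldots,\\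 c_3 &= -\sum_{r\ge1}\frac{2r-1}{(4^{r}+2)^{4}}\big(6\cdot64^{r}(2r^{3}-5r^{2}+4r-1) - 6\cdot16^{r}(16r^{3}-24r^{2}+10r-1) + 24\cdot4^{r}(2r-1)r^{2}\big) - 2c_0c_1\\ &= -9.16217532008362749969\ldots, \end{align*} one has \[ \mathbb{E}D_n = c_0 + c_1n^{-1} + O(n^{-2}),\qquad \mathbb{V}D_n = c_2 + c_3 n^{-1} + O(n^{-2}). \]
   Context: A rooted plane tree has ordered children at every node; its size is its number of nodes. For each child $c$ of the root, the rightmost leaf of the branch at $c$ is the leaf reached from $c$ by repeatedly moving to the rightmost child. A Catalan--Stanley tree is a rooted plane tree in which every such rightmost leaf has odd distance to the root (the one-node tree is included); there are $C_{n-2}$ of them of size $n\ge2$. The reduction $\rho$: for each rightmost leaf $\ell$ of a branch attached to the root, if $\ell$ is a child of the root it is deleted; otherwise all descendants of the grandparent of $\ell$ are deleted (the grandparent becomes a leaf); the one-node tree is mapped to itself. The age of a Catalan--Stanley tree $\tau$ is the least $r\ge0$ such that $\rho^{r}(\tau)$ is the one-node tree. $D_n$ is the age of a Catalan--Stanley tree chosen uniformly at random among those of size $n$. *)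

theory Defs
  imports "HOL-Probability.Probability"
begin

datatype plane_tree = PNode "plane_tree list"

fun num_nodes :: "plane_tree \<Rightarrow> nat" where
  "num_nodes (PNode ts) = 1 + (\<Sum>t\<leftarrow>ts. num_nodes t)"

text \<open>Distance from the root of a tree to its rightmost leaf, i.e. the leaf reached by
  repeatedly moving to the rightmost (last) child.\<close>

function rightmost_depth :: "plane_tree \<Rightarrow> nat" where
  "rightmost_depth (PNode ts) = (if ts = [] then 0 else 1 + rightmost_depth (last ts))"
  by pat_completeness auto
termination
  by (relation "Wellfounded.measure size") (auto simp: less_Suc_eq_le intro: size_list_estimation'[OF last_in_set])

text \<open>For a branch at a child \<open>c\<close> of the root, the rightmost leaf lies at distance
  \<open>1 + rightmost_depth c\<close> from the root.\<close>

fun catalan_stanley :: "plane_tree \<Rightarrow> bool" where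
  "catalan_stanley (PNode ts) \<longleftrightarrow> (\<forall>c\<in>set ts. odd (1 + rightmost_depth c))"

text \<open>For a tree whose rightmost leaf has depth at least 2, \<open>prune\<close> deletes all descendants of
  the grandparent of that leaf: it walks down the rightmost path to the node lying exactly two levels
  above the rightmost leaf and turns it into a leaf. Trees with a rightmost leaf of smaller depth are
  left unchanged; among the branches of a Catalan--Stanley tree only single leaves are of that
  kind, and \<open>reduction\<close> removes those beforehand.\<close>

function prune :: "plane_tree \<Rightarrow> plane_tree" where
  "prune (PNode ts) =
     (if ts = [] \<or> rightmost_depth (PNode ts) = 2 then PNode []
      else PNode (butlast ts @ [prune (last ts)]))"
  by pat_completeness auto
termination
  by (relation "Wellfounded.measure size") (auto simp: less_Suc_eq_le intro: size_list_estimation'[OF last_in_set])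

fun reduction :: "plane_tree \<Rightarrow> plane_tree" where
  "reduction (PNode ts) = PNode (map prune (filter (\<lambda>c. c \<noteq> PNode []) ts))"

definition age :: "plane_tree \<Rightarrow> nat" where
  "age t = (LEAST r. (reduction ^^ r) t = PNode [])"

definition random_cs_tree :: "nat \<Rightarrow> plane_tree pmf" where
  "random_cs_tree n = pmf_of_set {t. catalan_stanley t \<and> num_nodes t = n}"

definition c0 :: real where
  "c0 = (\<Sum>\<^sub>\<infinity>r\<in>{1::nat..}. (4 ^ (r + 1) * (3 * real r - 1) + 4) / (4 ^ r + 2)\<^sup>2)"

definition c1 :: real where
  "c1 = - (\<Sum>\<^sub>\<infinity>r\<in>{1::nat..}.
     (6 * 64 ^ r * (2 * real r ^ 3 - 5 * real r ^ 2 + 4 * real r - 1)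
      - 6 * 16 ^ r * (16 * real r ^ 3 - 24 * real r ^ 2 + 10 * real r - 1)
      + 24 * 4 ^ r * (2 * real r - 1) * real r ^ 2) / (4 ^ r + 2) ^ 4)"

definition c2 :: real where
  "c2 = (\<Sum>\<^sub>\<infinity>r\<in>{1::nat..}.
     (2 * real r - 1) * ((4 ^ (r + 1) * (3 * real r - 1) + 4) / (4 ^ r + 2)\<^sup>2)) - c0\<^sup>2"

definition c3 :: real where
  "c3 = - (\<Sum>\<^sub>\<infinity>r\<in>{1::nat..}.
     (2 * real r - 1) / (4 ^ r + 2) ^ 4 *
     (6 * 64 ^ r * (2 * real r ^ 3 - 5 * real r ^ 2 + 4 * real r - 1)
      - 6 * 16 ^ r * (16 * real r ^ 3 - 24 * real r ^ 2 + 10 * real r - 1)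
      + 24 * 4 ^ r * (2 * real r - 1) * real r ^ 2)) - 2 * c0 * c1"

end

theory Submission
  imports Defs "HOL-Computational_Algebra.Formal_Power_Series" "HOL-Real_Asymp.Real_Asymp"
begin

text \<open>
  The reduction shortens every rightmost path by two levels, so the age of a Catalan--Stanley tree is
  the maximum of \<open>k + 1\<close> over its branches, where \<open>2 k\<close> is the depth of the rightmost leaf of the branch.
  With \<open>T = z + T\<^sup>2\<close> the generating function of plane trees, branches of depth \<open>2 k\<close> are counted
  by \<open>z T\<^sup>2\<^sup>k\<close>, and for \<open>s = 2 r - 1\<close> trees of age at least \<open>r\<close> are counted by
  \<open>z (1 + T) T\<^sup>s / (1 + T\<^sup>s)\<close>.
  Expanding the geometric series, the tail probability of the age is an alternating sum of ratios of
  ballot numbers \<open>[z\<^sup>N] T\<^sup>k / [z\<^sup>N] T = k \<Prod>\<^bsub>0<i<k\<^esub> (N - i) / (2 N - 1 - i)\<close>, \<open>N = n - 1\<close>.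
  Each of them equals \<open>2 k / 2\<^sup>k (1 - (k - 1) (k - 2) / (4 n))\<close> up to an error \<open>O(k\<^sup>5 / (2\<^sup>k n\<^sup>2))\<close>
  that is uniform in \<open>k\<close>, so the expansion can be summed termwise, over the series and over \<open>r\<close> for the moments.
\<close>

subsection \<open>Generating functions of Catalan--Stanley trees by age\<close>

unbundle no vec_syntax
unbundle fps_syntax

text \<open>The obstacle is uniformity: an asymptotic expansion for each fixed power of T would
  leave an error constant that depends on r, whereas the moments need one constant for all r. Exact
  products avoid this, since their error k^5/2^k also covers k > N + 1, where the coefficient
  vanishes, and is summable over k = (i + 1) (2 r - 1). The factor 1 + T pairs the exponents k and k
  + 1, and the two main terms add up to (3 k + 1)/2^k - 3 k (k - 1)^2/(4 n 2^k). Summed over i with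
  alternating signs these are negative binomial series in x = 2^-(2 r - 1) = 2/4^r, and 1 + x = (4^r
  + 2)/4^r is the origin of the denominators (4^r + 2)^2 and (4^r + 2)^4. Tails are used instead of
  point probabilities because the first two moments are linear in them, with weights 1 and 2 r - 1.
  Their error is even O(r^5/(4^r n^2)); the rate 3^r appears only when the point probabilities are
  bounded.\<close>

lemma num_nodes_pos: "num_nodes t > 0"
  by (cases t) simp

text \<open>A tree with at most n + 1 nodes has at most n children, each with at most n nodes.
  Finiteness is what makes \<open>card\<close> a genuine count below, as \<open>card\<close> of an
  infinite set is 0.\<close>

lemma finite_num_nodes_le: "finite {t. num_nodes t \<le> n}"
proof (induction n)
  case 0
  have "{t. num_nodes t \<le> 0} = {}"
    using num_nodes_pos by auto
  then show ?case by (metis finite.emptyI)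
next
  case (Suc n)
  have "{t. num_nodes t \<le> Suc n} \<subseteq> PNode ` {ts. set ts \<subseteq> {t. num_nodes t \<le> n} \<and> length ts \<le> n}"
  proof
    fix t assume "t \<in> {t. num_nodes t \<le> Suc n}"
    moreover obtain ts where t: "t = PNode ts" by (cases t)
    ultimately have le: "(\<Sum>c\<leftarrow>ts. num_nodes c) \<le> n" by simp
    have "length ts \<le> (\<Sum>c\<leftarrow>ts. num_nodes c)"
    proof (induction ts)
      case (Cons c ts)
      then show ?case using num_nodes_pos[of c] by simp
    qed simp
    moreover have "num_nodes c \<le> (\<Sum>c\<leftarrow>ts. num_nodes c)" if "c \<in> set ts" for c
      using that by (intro member_le_sum_list) auto
    ultimately show "t \<in> PNode ` {ts. set ts \<subseteq> {t. num_nodes t \<le> n} \<and> length ts \<le> n}"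
      using le t by (intro image_eqI[of _ _ ts]) (auto intro: order_trans)
  qed
  then show ?case
    by (rule finite_subset) (intro finite_imageI finite_lists_length_le Suc.IH)
qed

lemma finite_num_nodes_eq: "finite {t. P t \<and> num_nodes t = n}"
  by (rule finite_subset[OF _ finite_num_nodes_le[of n]]) auto

definition tree_gf :: "plane_tree set \<Rightarrow> real fps" where
  "tree_gf A = Abs_fps (\<lambda>n. real (card {t. t \<in> A \<and> num_nodes t = n}))"

lemma tree_gf_nth: "tree_gf A $ n = real (card {t. t \<in> A \<and> num_nodes t = n})"
  by (simp add: tree_gf_def)

lemma tree_gf_Un:
  assumes "A \<inter> B = {}"
  shows "tree_gf (A \<union> B) = tree_gf A + tree_gf B"
proof (rule fps_ext)
  fix n
  have "{t. t \<in> A \<union> B \<and> num_nodes t = n} =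
      {t. t \<in> A \<and> num_nodes t = n} \<union> {t. t \<in> B \<and> num_nodes t = n}" by auto
  then show "tree_gf (A \<union> B) $ n = (tree_gf A + tree_gf B) $ n"
    using assms by (simp add: tree_gf_nth card_Un_disjoint finite_num_nodes_eq disjoint_iff)
qed

lemma tree_gf_leaf: "tree_gf {PNode []} = fps_X"
proof (rule fps_ext)
  fix n
  have "{t. t \<in> {PNode []} \<and> num_nodes t = n} = (if n = 1 then {PNode []} else {})" by auto
  then show "tree_gf {PNode []} $ n = fps_X $ n" by (simp add: tree_gf_nth)
qed

text \<open>Product rule for an arbitrary size-additive pairing. It is used with two pairings:
  attaching a first branch and attaching a last child to the root of another tree. The root belongs
  to that other tree, so sizes add without correction.\<close>

lemma tree_gf_prod:
  assumes inj: "inj_on f (A \<times> B)"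
    and size: "\<And>a b. a \<in> A \<Longrightarrow> b \<in> B \<Longrightarrow> num_nodes (f (a, b)) = num_nodes a + num_nodes b"
  shows "tree_gf (f ` (A \<times> B)) = tree_gf A * tree_gf B"
proof (rule fps_ext)
  fix n
  let ?L = "\<lambda>A i. {t. t \<in> A \<and> num_nodes t = i}"
  have eq: "?L (f ` (A \<times> B)) n = f ` (\<Union>i\<in>{0..n}. ?L A i \<times> ?L B (n - i))"
    (is "_ = f ` ?U")
  proof (intro equalityI subsetI)
    fix t assume "t \<in> ?L (f ` (A \<times> B)) n"
    then obtain a b where ab: "a \<in> A" "b \<in> B" "t = f (a, b)" "num_nodes t = n" by auto
    then have "num_nodes a + num_nodes b = n" using size by simp
    then have "(a, b) \<in> ?U" using ab by auto
    then show "t \<in> f ` ?U" using ab by blast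
  qed (auto simp: size)
  have "card (f ` ?U) = card ?U"
    by (intro card_image inj_on_subset[OF inj]) auto
  also have "\<dots> = (\<Sum>i=0..n. card (?L A i \<times> ?L B (n - i)))"
    by (intro card_UN_disjoint) (auto intro!: finite_cartesian_product finite_num_nodes_eq)
  finally show "tree_gf (f ` (A \<times> B)) $ n = (tree_gf A * tree_gf B) $ n"
    by (simp add: tree_gf_nth fps_mult_nth eq card_cartesian_product)
qed

text \<open>Such a tree is a leaf, or splits uniquely into its first branch and the tree formed by
  the root and the remaining branches. The implicit equation takes the place of the quotient z / (1
  - A(z)).\<close>

lemma tree_gf_branches:
  "tree_gf {PNode ts |ts. set ts \<subseteq> A} = fps_X + tree_gf A * tree_gf {PNode ts |ts. set ts \<subseteq> A}"
proof -
  define X where "X = {PNode ts |ts. set ts \<subseteq> A}"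
  define f where "f = (\<lambda>(c, t). case t of PNode ts \<Rightarrow> PNode (c # ts))"
  have "X = {PNode []} \<union> f ` (A \<times> X)"
  proof (intro equalityI subsetI)
    fix t assume "t \<in> X"
    then obtain ts where ts: "t = PNode ts" "set ts \<subseteq> A" by (auto simp: X_def)
    show "t \<in> {PNode []} \<union> f ` (A \<times> X)"
    proof (cases ts)
      case (Cons c us)
      then have "t = f (c, PNode us)" "(c, PNode us) \<in> A \<times> X"
        using ts by (auto simp: f_def X_def)
      then show ?thesis by blast
    qed (use ts in auto)
  qed (auto simp: X_def f_def)
  moreover have "tree_gf (f ` (A \<times> X)) = tree_gf A * tree_gf X"
    by (rule tree_gf_prod) (auto simp: inj_on_def f_def X_def split: plane_tree.splits)
  moreover have "{PNode []} \<inter> f ` (A \<times> X) = {}"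
    by (auto simp: f_def split: plane_tree.splits)
  ultimately have "tree_gf X = fps_X + tree_gf A * tree_gf X"
    by (metis tree_gf_Un tree_gf_leaf)
  then show ?thesis by (simp only: X_def)
qed

abbreviation "T \<equiv> tree_gf UNIV"

lemma T_eq: "T = fps_X + T * T"
proof -
  have "{PNode ts |ts. set ts \<subseteq> UNIV} = (UNIV :: plane_tree set)"
    by (auto intro: plane_tree.exhaust)
  then show ?thesis using tree_gf_branches[of UNIV] by (simp only:)
qed

text \<open>Cutting off the last branch leaves an arbitrary tree and shortens the rightmost path by
  one, so each edge of that path contributes a factor T and its final leaf a factor z.\<close>

lemma tree_gf_rightmost_depth: "tree_gf {t. rightmost_depth t = d} = fps_X * T ^ d"
proof (induction d)
  case 0
  have "{t. rightmost_depth t = 0} = {PNode []}"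
    by (auto elim: rightmost_depth.elims split: if_splits)
  then show ?case by (simp add: tree_gf_leaf)
next
  case (Suc d)
  define f where "f = (\<lambda>(t, c). case t of PNode ts \<Rightarrow> PNode (ts @ [c]))"
  have "{t. rightmost_depth t = Suc d} = f ` (UNIV \<times> {t. rightmost_depth t = d})"
  proof (intro equalityI subsetI)
    fix t assume t: "t \<in> {t. rightmost_depth t = Suc d}"
    obtain ts where ts: "t = PNode ts" by (cases t)
    then have "ts \<noteq> []" "rightmost_depth (last ts) = d"
      using t by (auto split: if_splits)
    then have "t = f (PNode (butlast ts), last ts)" "(PNode (butlast ts), last ts) \<in> UNIV \<times> {t. rightmost_depth t = d}"
      using ts by (auto simp: f_def)
    then show "t \<in> f ` (UNIV \<times> {t. rightmost_depth t = d})" by blast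
  qed (auto simp: f_def split: plane_tree.splits)
  moreover have "tree_gf (f ` (UNIV \<times> {t. rightmost_depth t = d})) = T * tree_gf {t. rightmost_depth t = d}"
    by (rule tree_gf_prod) (auto simp: inj_on_def f_def split: plane_tree.splits)
  ultimately show ?case by (simp add: Suc.IH ac_simps)
qed

lemma tree_gf_even_depth:
  "tree_gf {t. even (rightmost_depth t) \<and> rightmost_depth t < 2 * r} = fps_X * (\<Sum>k<r. T ^ (2 * k))"
proof (induction r)
  case 0
  then show ?case by (simp add: tree_gf_def fps_zero_def)
next
  case (Suc r)
  have "{t. even (rightmost_depth t) \<and> rightmost_depth t < 2 * Suc r} =
      {t. even (rightmost_depth t) \<and> rightmost_depth t < 2 * r} \<union> {t. rightmost_depth t = 2 * r}"
    by (auto elim!: evenE)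
  moreover have "tree_gf \<dots> = tree_gf {t. even (rightmost_depth t) \<and> rightmost_depth t < 2 * r}
      + tree_gf {t. rightmost_depth t = 2 * r}"
    by (rule tree_gf_Un) auto
  ultimately show ?case
    by (simp only: Suc.IH tree_gf_rightmost_depth) (simp add: algebra_simps)
qed

section \<open>Effect of the reduction on rightmost paths; the age as a condition on the
  branches\<close>

lemma rightmost_depth_prune:
  "2 \<le> rightmost_depth t \<Longrightarrow> rightmost_depth (prune t) = rightmost_depth t - 2"
  by (induction t rule: prune.induct) (auto split: if_splits)

text \<open>One reduction deletes the branches of depth 0 and lowers every other depth, which is
  even and hence at least 2, by exactly two. Parity is preserved, so the argument iterates.\<close>

lemma reduction_iterate_eq_leaf_iff:
  assumes "\<forall>c\<in>set ts. even (rightmost_depth c)"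
  shows "(reduction ^^ r) (PNode ts) = PNode [] \<longleftrightarrow> (\<forall>c\<in>set ts. rightmost_depth c < 2 * r)"
  using assms
proof (induction r arbitrary: ts)
  case 0
  then show ?case by auto
next
  case (Suc r)
  define us where "us = map prune (filter (\<lambda>c. c \<noteq> PNode []) ts)"
  have leaf: "rightmost_depth c = 0 \<longleftrightarrow> c = PNode []" for c
    by (cases c) auto
  have depth: "rightmost_depth (prune c) = rightmost_depth c - 2" "rightmost_depth c \<ge> 2"
    if "c \<in> set ts" "c \<noteq> PNode []" for c
  proof -
    have "even (rightmost_depth c)" "rightmost_depth c \<noteq> 0"
      using that Suc.prems leaf by auto
    then show "rightmost_depth c \<ge> 2" by presburger
    then show "rightmost_depth (prune c) = rightmost_depth c - 2" by (rule rightmost_depth_prune)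
  qed
  have even: "\<forall>c\<in>set us. even (rightmost_depth c)"
    using Suc.prems depth by (auto simp: us_def)
  have "(reduction ^^ Suc r) (PNode ts) = (reduction ^^ r) (PNode us)"
    by (simp add: funpow_Suc_right us_def del: funpow.simps)
  moreover have "(\<forall>c\<in>set us. rightmost_depth c < 2 * r) \<longleftrightarrow> (\<forall>c\<in>set ts. rightmost_depth c < 2 * Suc r)"
  proof -
    have "(\<forall>c\<in>set us. rightmost_depth c < 2 * r) \<longleftrightarrow>
        (\<forall>c\<in>set ts. c \<noteq> PNode [] \<longrightarrow> rightmost_depth (prune c) < 2 * r)"
      by (auto simp: us_def)
    also have "\<dots> \<longleftrightarrow> (\<forall>c\<in>set ts. c \<noteq> PNode [] \<longrightarrow> rightmost_depth c < 2 * Suc r)"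
      using depth by (intro ball_cong refl imp_cong) (simp add: less_diff_conv2)
    also have "\<dots> \<longleftrightarrow> (\<forall>c\<in>set ts. rightmost_depth c < 2 * Suc r)"
      using leaf by (metis zero_less_Suc mult_pos_pos zero_less_numeral)
    finally show ?thesis .
  qed
  ultimately show ?case using Suc.IH[OF even] by simp
qed

lemma rightmost_depth_less_num_nodes: "rightmost_depth t < num_nodes t"
proof (induction t rule: rightmost_depth.induct)
  case (1 ts)
  show ?case
  proof (cases "ts = []")
    case False
    then have "num_nodes (last ts) \<le> (\<Sum>c\<leftarrow>ts. num_nodes c)"
      by (intro member_le_sum_list) auto
    then show ?thesis using 1[OF False] False by simp
  qed simp
qed

lemma age_le_iff:
  assumes "\<forall>c\<in>set ts. even (rightmost_depth c)"
  shows "age (PNode ts) \<le> r \<longleftrightarrow> (\<forall>c\<in>set ts. rightmost_depth c < 2 * r)"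
proof
  \<comment> \<open>\<open>LEAST\<close> is only meaningful once some iterate reaches the one-node
    tree; the number of nodes serves, since it exceeds every rightmost depth.\<close>
  have ex: "(reduction ^^ num_nodes (PNode ts)) (PNode ts) = PNode []"
    unfolding reduction_iterate_eq_leaf_iff[OF assms]
  proof
    fix c assume "c \<in> set ts"
    then have "num_nodes c \<le> (\<Sum>c\<leftarrow>ts. num_nodes c)"
      by (intro member_le_sum_list) auto
    then show "rightmost_depth c < 2 * num_nodes (PNode ts)"
      using rightmost_depth_less_num_nodes[of c] by simp
  qed
  assume "age (PNode ts) \<le> r"
  moreover have "(reduction ^^ age (PNode ts)) (PNode ts) = PNode []"
    unfolding age_def by (rule LeastI) (rule ex)
  ultimately show "\<forall>c\<in>set ts. rightmost_depth c < 2 * r"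
    unfolding reduction_iterate_eq_leaf_iff[OF assms] by fastforce
next
  assume "\<forall>c\<in>set ts. rightmost_depth c < 2 * r"
  then show "age (PNode ts) \<le> r"
    unfolding age_def reduction_iterate_eq_leaf_iff[OF assms, symmetric] by (rule Least_le)
qed

lemma age_le_num_nodes:
  assumes "catalan_stanley t"
  shows "age t \<le> num_nodes t"
proof -
  obtain ts where t: "t = PNode ts" by (cases t)
  have "rightmost_depth c < 2 * num_nodes t" if "c \<in> set ts" for c
  proof -
    have "num_nodes c \<le> (\<Sum>c\<leftarrow>ts. num_nodes c)"
      using that by (intro member_le_sum_list) auto
    then show ?thesis using rightmost_depth_less_num_nodes[of c] t by simp
  qed
  then show ?thesis using age_le_iff[of ts] assms t by auto
qed

text \<open>The branches give F = z + z S F with S = 1 + T^2 + ... + T^(2 r - 2). Since z = T (1 -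
  T), multiplying by 1 + T turns z S into T (1 - T^2) S, which telescopes to T - T^(2 r + 1). The
  product form avoids dividing power series.\<close>

lemma tree_gf_age_le:
  "tree_gf {t. catalan_stanley t \<and> age t \<le> r} * (1 + T ^ (2 * r + 1)) = fps_X * (1 + T)"
proof -
  define F where "F = tree_gf {t. catalan_stanley t \<and> age t \<le> r}"
  define S where "S = (\<Sum>k<r. T ^ (2 * k))"
  have "catalan_stanley (PNode ts) \<and> age (PNode ts) \<le> r \<longleftrightarrow>
      set ts \<subseteq> {t. even (rightmost_depth t) \<and> rightmost_depth t < 2 * r}" for ts
    using age_le_iff[of ts r] by auto
  then have "t \<in> {t. catalan_stanley t \<and> age t \<le> r} \<longleftrightarrow>
      t \<in> {PNode ts |ts. set ts \<subseteq> {t. even (rightmost_depth t) \<and> rightmost_depth t < 2 * r}}" for t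
    by (cases t) (simp del: catalan_stanley.simps)
  then have set_eq: "{t. catalan_stanley t \<and> age t \<le> r} =
      {PNode ts |ts. set ts \<subseteq> {t. even (rightmost_depth t) \<and> rightmost_depth t < 2 * r}}"
    by (rule set_eqI)
  have F: "F = fps_X + fps_X * S * F"
    unfolding F_def set_eq S_def tree_gf_even_depth[symmetric] by (rule tree_gf_branches)
  have X: "fps_X = T - T * T" by (metis T_eq add_diff_cancel_right')
  have S: "S * (1 - T * T) = 1 - T ^ (2 * r)"
    unfolding S_def
  proof (induction r)
    case (Suc r)
    have "(\<Sum>k<Suc r. T ^ (2 * k)) * (1 - T * T) =
        (\<Sum>k<r. T ^ (2 * k)) * (1 - T * T) + T ^ (2 * r) * (1 - T * T)"
      by (simp add: algebra_simps)
    also have "\<dots> = 1 - T ^ (2 * Suc r)"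
      unfolding Suc.IH by (simp add: algebra_simps)
    finally show ?case .
  qed simp
  have "fps_X * (1 + T) * S = T * (S * (1 - T * T))"
    unfolding X by (simp add: algebra_simps)
  also have "\<dots> = T - T ^ (2 * r + 1)"
    unfolding S by (simp add: algebra_simps)
  finally have XS: "fps_X * (1 + T) * S = T - T ^ (2 * r + 1)" .
  have "fps_X * (1 + T) = (F - fps_X * S * F) * (1 + T)"
    by (metis F add_diff_cancel_right')
  also have "\<dots> = F * (1 + T - fps_X * (1 + T) * S)"
    by (simp add: algebra_simps)
  also have "\<dots> = F * (1 + T ^ (2 * r + 1))"
    unfolding XS by simp
  finally show ?thesis by (simp add: F_def)
qed

section \<open>Counting Catalan--Stanley trees of given size and age\<close>

lemma T_nth_0: "T $ 0 = 0"
  using num_nodes_pos by (simp add: tree_gf_nth less_imp_neq[symmetric])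

lemma T_power_nth_eq_0: "n < k \<Longrightarrow> (T ^ k) $ n = 0"
  using startsby_zero_power_prefix[OF T_nth_0, of k] by blast

lemma T_power_mult_nth_eq_0: "n < k \<Longrightarrow> (T ^ k * f) $ n = 0"
  by (simp add: fps_mult_nth T_power_nth_eq_0)

text \<open>The age never exceeds the size, so the bound \<open>n\<close> on the age excludes no
  tree of size n. The correction T^(2 n + 1) F has no term of degree n, which leaves [z^n] z (1 +
  T); from n = 2 on the summand z does not contribute.\<close>

lemma card_catalan_stanley:
  assumes "n \<ge> 2"
  shows "real (card {t. catalan_stanley t \<and> num_nodes t = n}) = T $ (n - 1)"
proof -
  let ?F = "tree_gf {t. catalan_stanley t \<and> age t \<le> n}"
  have "{t. catalan_stanley t \<and> num_nodes t = n} = {t. t \<in> {t. catalan_stanley t \<and> age t \<le> n} \<and> num_nodes t = n}"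
    using age_le_num_nodes by auto
  then have "real (card {t. catalan_stanley t \<and> num_nodes t = n}) = ?F $ n"
    by (simp add: tree_gf_nth)
  also have "?F = fps_X * (1 + T) - T ^ (2 * n + 1) * ?F"
    unfolding tree_gf_age_le[of n, symmetric] by (simp add: algebra_simps)
  also have "\<dots> $ n = (fps_X * (1 + T)) $ n"
    by (simp add: T_power_mult_nth_eq_0 del: power_Suc)
  also have "\<dots> = T $ (n - 1)"
    using assms by (cases n) (auto simp: fps_X_mult_nth)
  finally show ?thesis .
qed

text \<open>The complement consists of the trees of age at most r - 1, whence the exponent s = 2 (r
  - 1) + 1 = 2 r - 1. The difference of the two generating functions is T^s F in degree n; unrolling
  F = z (1 + T) - T^s F repeatedly gives the alternating sum with a remainder divisible by T^((M +
  1) s), which has no term of degree n because M > n.\<close>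

lemma card_age_ge:
  assumes "n \<ge> 2" "r \<ge> 1" "M > n"
  shows "real (card {t. catalan_stanley t \<and> num_nodes t = n \<and> r \<le> age t}) =
    (\<Sum>i<M. (-1) ^ i * ((T ^ ((i + 1) * (2 * r - 1))) $ (n - 1) + (T ^ ((i + 1) * (2 * r - 1) + 1)) $ (n - 1)))"
proof -
  define s where "s = 2 * r - 1"
  define F where "F = tree_gf {t. catalan_stanley t \<and> age t \<le> r - 1}"
  have s: "2 * (r - 1) + 1 = s" "s \<ge> 1" using assms by (auto simp: s_def)
  have F: "F * (1 + T ^ s) = fps_X * (1 + T)"
    using tree_gf_age_le[of "r - 1"] by (simp only: F_def s)
  have "{t. catalan_stanley t \<and> num_nodes t = n} =
     {t. catalan_stanley t \<and> num_nodes t = n \<and> r \<le> age t} \<union>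
     {t. t \<in> {t. catalan_stanley t \<and> age t \<le> r - 1} \<and> num_nodes t = n}"
    using assms by auto
  moreover have "card \<dots> = card {t. catalan_stanley t \<and> num_nodes t = n \<and> r \<le> age t} +
     card {t. t \<in> {t. catalan_stanley t \<and> age t \<le> r - 1} \<and> num_nodes t = n}"
    using assms
    by (intro card_Un_disjoint finite_num_nodes_eq finite_subset[OF _ finite_num_nodes_eq[of catalan_stanley n]]) auto
  ultimately have "real (card {t. catalan_stanley t \<and> num_nodes t = n \<and> r \<le> age t}) = T $ (n - 1) - F $ n"
    using card_catalan_stanley[OF assms(1)] by (simp add: F_def tree_gf_nth)
  also have "T $ (n - 1) = (fps_X * (1 + T)) $ n"
    using assms by (cases n) (auto simp: fps_X_mult_nth)
  also have "\<dots> - F $ n = (T ^ s * F) $ n"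
    unfolding F[symmetric] by (simp add: algebra_simps)
  also have "T ^ s * F = (\<Sum>i<M. (-1) ^ i * (fps_X * (1 + T)) * T ^ ((i + 1) * s)) + (-1) ^ M * T ^ ((M + 1) * s) * F"
  proof (induction M)
    case (Suc M)
    have "T ^ ((M + 1) * s) * F = T ^ ((M + 1) * s) * (F * (1 + T ^ s)) - T ^ ((Suc M + 1) * s) * F"
      by (simp add: algebra_simps power_add)
    then have "T ^ ((M + 1) * s) * F = T ^ ((M + 1) * s) * (fps_X * (1 + T)) - T ^ ((Suc M + 1) * s) * F"
      unfolding F .
    then have "(-1) ^ M * T ^ ((M + 1) * s) * F =
        (-1) ^ M * (fps_X * (1 + T)) * T ^ ((M + 1) * s) + (-1) ^ Suc M * T ^ ((Suc M + 1) * s) * F"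
      by (simp only: mult.assoc) (simp add: algebra_simps)
    with Suc.IH show ?case
      by (simp only: sum.lessThan_Suc add.assoc)
  qed simp
  also have "\<dots> $ n = (\<Sum>i<M. ((-1) ^ i * (fps_X * (1 + T)) * T ^ ((i + 1) * s)) $ n)"
  proof -
    have "n < (M + 1) * s" using assms s
      by (metis add_lessD1 less_le_trans mult.right_neutral mult_le_mono2 trans_less_add1)
    then have "(T ^ ((M + 1) * s) * ((-1) ^ M * F)) $ n = 0"
      by (rule T_power_mult_nth_eq_0)
    then show ?thesis by (simp add: fps_sum_nth mult_ac)
  qed
  also have "\<dots> = (\<Sum>i<M. (-1) ^ i * ((T ^ ((i + 1) * s)) $ (n - 1) + (T ^ ((i + 1) * s + 1)) $ (n - 1)))"
  proof (intro sum.cong refl)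
    fix i
    have "(-1) ^ i * (fps_X * (1 + T)) * T ^ ((i + 1) * s) =
        fps_const ((-1) ^ i) * (fps_X * (T ^ ((i + 1) * s) + T ^ ((i + 1) * s + 1)))"
      by (simp add: algebra_simps fps_const_power[symmetric] fps_const_neg[symmetric] del: fps_const_neg)
    then show "((-1) ^ i * (fps_X * (1 + T)) * T ^ ((i + 1) * s)) $ n =
       (-1) ^ i * ((T ^ ((i + 1) * s)) $ (n - 1) + (T ^ ((i + 1) * s + 1)) $ (n - 1))"
      using assms by (simp only: fps_mult_left_const_nth fps_X_mult_nth fps_add_nth) simp
  qed
  finally show ?thesis by (simp add: s_def)
qed

section \<open>Ballot numbers as coefficients of powers of T\<close>

text \<open>From T = z + T^2 one gets T^(j + 1) = z T^j + T^(j + 2), which is Pascal's rule for the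
  difference of binomials; both terms on the right have smaller 3 n - k. The case distinction is
  essential, since subtraction on naturals truncates: for n = 1, k = 2 the binomials would give 1
  instead of 0.\<close>

lemma T_power_nth:
  assumes "1 \<le> k" "1 \<le> n"
  shows "(T ^ k) $ n = (if n < k then 0 else real ((2 * n - k - 1) choose (n - 1)) - real ((2 * n - k - 1) choose n))"
  using assms
proof (induction "3 * n - k" arbitrary: n k rule: less_induct)
  case less
  show ?case
  proof (cases "n < k")
    case True
    then show ?thesis by (simp add: T_power_nth_eq_0)
  next
    case False
    obtain j where j: "k = Suc j" using less.prems by (cases k) auto
    obtain m where m: "n = Suc m" using less.prems by (cases n) auto
    have jm: "j \<le> m" using False j m by simp
    have "T ^ Suc j = fps_X * T ^ j + T ^ (j + 2)"
    proof -
      have "T ^ Suc j = (fps_X + T * T) * T ^ j"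
        by (metis T_eq power_Suc)
      then show ?thesis by (simp add: algebra_simps)
    qed
    then have rec: "(T ^ k) $ n = (T ^ j) $ m + (T ^ (j + 2)) $ n"
      unfolding j by (simp only: fps_add_nth fps_X_mult_nth) (simp add: m)
    have second: "(T ^ (j + 2)) $ n = (if n < j + 2 then 0 else real ((2 * n - (j + 2) - 1) choose (n - 1)) - real ((2 * n - (j + 2) - 1) choose n))"
      using less.prems False j by (intro less.hyps) auto
    show ?thesis
    proof (cases "j = 0")
      case True
      show ?thesis
      proof (cases m)
        case 0
        then show ?thesis using True second rec j m T_nth_0 by simp
      next
        case (Suc l)
        \<comment> \<open>The formula does not cover T^0, which contributes nothing in positive
          degree. The symmetry of the binomials with upper index 2 l + 1 makes up for the missing
          Pascal summand.\<close>
        have "(T ^ j) $ m = 0" using True Suc by simp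
        moreover have "Suc (l + l) choose l = Suc (l + l) choose Suc l"
          using binomial_symmetric[of l "Suc (l + l)"] by (simp del: binomial_Suc_Suc)
        ultimately show ?thesis
          unfolding rec using second True Suc j m
          by (simp add: numeral_2_eq_2)
      qed
    next
      case False
      have "m \<ge> 1" using False jm by simp
      then have first: "(T ^ j) $ m = (if m < j then 0 else real ((2 * m - j - 1) choose (m - 1)) - real ((2 * m - j - 1) choose m))"
        using less.prems False j m jm by (intro less.hyps) auto
      show ?thesis
      proof (cases "j = m")
        case True
        then show ?thesis unfolding rec first second using j m \<open>m \<ge> 1\<close> by (cases m) auto
      next
        case False
        obtain l where l: "m = Suc l" using \<open>m \<ge> 1\<close> by (cases m) auto
        \<comment> \<open>Both summands have the same upper index d, and the target has d +
          1.\<close>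
        define d where "d = 2 * m - j - 1"
        have d: "2 * n - k - 1 = Suc d" "2 * n - (j + 2) - 1 = d"
          using jm False j m \<open>m \<ge> 1\<close> by (auto simp: d_def)
        show ?thesis unfolding rec first second d d_def[symmetric]
          using False jm j m l by simp
      qed
    qed
  qed
qed

lemma T_nth_pos: "1 \<le> n \<Longrightarrow> T $ n > 0"
proof -
  assume n: "1 \<le> n"
  let ?t = "PNode (replicate (n - 1) (PNode []))"
  have "num_nodes ?t = n" using n by (simp add: sum_list_replicate)
  then have "?t \<in> {t. t \<in> UNIV \<and> num_nodes t = n}" by simp
  then show ?thesis
    unfolding tree_gf_nth using finite_num_nodes_eq[of "\<lambda>t. t \<in> UNIV" n]
    by (metis card_gt_0_iff empty_iff of_nat_0_less_iff)
qed

text \<open>Since [z^n] T^j / j = C(2 n - j - 1, n - 1) / n, only the upper index depends on j, and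
  consecutive values have a rational quotient. For k = n both sides vanish.\<close>

lemma T_power_Suc_nth:
  assumes "1 \<le> k" "k \<le> n" "n \<ge> 2"
  shows "(T ^ Suc k) $ n / real (Suc k) = (T ^ k) $ n / real k * ((real n - real k) / (2 * real n - real k - 1))"
proof -
  have closed: "(T ^ j) $ n / real j = real ((2 * n - j - 1) choose (n - 1)) / real n"
    if j: "1 \<le> j" "j \<le> n" for j
  proof -
    obtain m where m: "n = Suc m" using j by (cases n) auto
    define d where "d = 2 * n - j - 1"
    have "Suc m * (d choose Suc m) = (d - m) * (d choose m)"
      by (metis Suc_times_binomial_add binomial_absorb_comp mult.commute binomial_absorption times_binomial_minus1_eq)
    then have "real n * real (d choose n) = real (d - m) * real (d choose m)"
      unfolding m by (metis of_nat_mult)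
    also have "real (d - m) = real n - real j"
      using j m by (auto simp: d_def)
    finally have "real n * (real (d choose m) - real (d choose n)) = real j * real (d choose m)"
      by (simp add: algebra_simps)
    moreover have "(T ^ j) $ n = real (d choose m) - real (d choose n)"
      using T_power_nth[of j n] j m d_def by simp
    ultimately have "real n * (T ^ j) $ n = real j * real (d choose (n - 1))"
      using m by simp
    then show ?thesis using j unfolding d_def[symmetric] by (simp add: field_simps)
  qed
  show ?thesis
  proof (cases "k = n")
    case True
    then show ?thesis by (simp add: T_power_nth_eq_0 del: power_Suc)
  next
    case False
    obtain m where m: "n = Suc m" using assms by (cases n) auto
    define d where "d = 2 * n - k - 2"
    have d: "2 * n - k - 1 = Suc d" "2 * n - Suc k - 1 = d" "d \<ge> m"
      using False assms m by (auto simp: d_def)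
    have "(Suc d - m) * (Suc d choose m) = Suc d * (d choose m)"
      using binomial_absorb_comp[of "Suc d" m] by simp
    then have "real (Suc d - m) * real (Suc d choose m) = real (Suc d) * real (d choose m)"
      by (metis of_nat_mult)
    moreover have "real (Suc d - m) = real n - real k" "real (Suc d) = 2 * real n - real k - 1"
      using False assms m by (auto simp: d_def)
    ultimately have "(2 * real n - real k - 1) * real (d choose m) = (real n - real k) * real (Suc d choose m)"
      "2 * real n - real k - 1 > 0"
      by (metis, linarith)
    then have "real (d choose m) = real (Suc d choose m) * ((real n - real k) / (2 * real n - real k - 1))"
      by (metis nonzero_eq_divide_eq less_imp_neq mult.commute times_divide_eq_right)
    moreover have "n - 1 = m" using m by simp
    moreover have "1 \<le> Suc k" "Suc k \<le> n" using False assms by auto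
    ultimately show ?thesis
      by (simp only: closed[OF assms(1,2)] closed[OF \<open>1 \<le> Suc k\<close> \<open>Suc k \<le> n\<close>] d) simp
  qed
qed

subsection \<open>Asymptotics of ratios of ballot numbers\<close>

text \<open>To first order the factors subtract (j - 1)/(2 N), and summing over j < k gives (k -
  1)(k - 2)/(4 N). The induction also carries 0 <= p k <= 1 and the crude bound on 1 - p k, because
  the product of the accumulated deviation with the next factor has to be of order 1/N^2.\<close>

lemma product_expansion:
  fixes p :: "nat \<Rightarrow> real" and N :: nat
  assumes N: "N \<ge> 2" and p1: "p 1 = 1"
    and step: "\<And>k. 1 \<le> k \<Longrightarrow> k \<le> N \<Longrightarrow> p (Suc k) = p k * (1 - (real k - 1) / (2 * real N - real k - 1))"
    and k: "1 \<le> k" "k \<le> Suc N"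
  shows "\<bar>p k - (1 - (real k - 1) * (real k - 2) / (4 * real N))\<bar> \<le> real k ^ 4 / real N ^ 2"
proof -
  have "0 \<le> p k \<and> p k \<le> 1 \<and> 1 - p k \<le> (real k - 1) * (real k - 2) / real N \<and>
      \<bar>p k - (1 - (real k - 1) * (real k - 2) / (4 * real N))\<bar> \<le> real k ^ 4 / real N ^ 2"
    using k
  proof (induction k rule: dec_induct)
    case base
    then show ?case using p1 by simp
  next
    case (step k)
    define x where "x = (real k - 1) / (2 * real N - real k - 1)"
    have k: "1 \<le> k" "k \<le> N" using step by auto
    have IH: "0 \<le> p k" "p k \<le> 1" "1 - p k \<le> (real k - 1) * (real k - 2) / real N"
      "\<bar>p k - (1 - (real k - 1) * (real k - 2) / (4 * real N))\<bar> \<le> real k ^ 4 / real N ^ 2"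
      using step by auto
    have p: "p (Suc k) = p k * (1 - x)" using assms(3)[OF k] by (simp add: x_def)
    have D: "2 * real N - real k - 1 \<ge> real N / 2" "real N \<ge> 2" "2 * real N - real k - 1 \<ge> real k - 1"
      using k N by auto
    have x0: "0 \<le> x" using k D by (simp add: x_def)
    have x1: "x \<le> 1" using k D unfolding x_def by (subst divide_le_eq_1) auto
    have "x \<le> (real k - 1) / (real N / 2)"
      unfolding x_def using k D by (intro divide_left_mono) auto
    then have x2: "x \<le> 2 * (real k - 1) / real N" by (simp add: mult.commute)
    have incr: "1 - p (Suc k) \<le> (real (Suc k) - 1) * (real (Suc k) - 2) / real N"
    proof -
      have "1 - p (Suc k) = (1 - p k) + p k * x" by (simp add: p algebra_simps)
      also have "\<dots> \<le> (real k - 1) * (real k - 2) / real N + 1 * (2 * (real k - 1) / real N)"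
        using IH x2 x0 k by (intro add_mono mult_mono) auto
      also have "\<dots> = (real (Suc k) - 1) * (real (Suc k) - 2) / real N"
        using D by (simp add: field_simps)
      finally show ?thesis .
    qed
    have x3: "0 \<le> x - (real k - 1) / (2 * real N)" "x - (real k - 1) / (2 * real N) \<le> real k ^ 2 / real N ^ 2"
    proof -
      have eq: "x - (real k - 1) / (2 * real N) = (real k - 1) * (real k + 1) / (2 * real N * (2 * real N - real k - 1))"
        using D unfolding x_def by (simp add: field_simps)
      show "0 \<le> x - (real k - 1) / (2 * real N)"
        unfolding eq using D k by simp
      have "(real k - 1) * (real k + 1) / (2 * real N * (2 * real N - real k - 1)) \<le>
          real k ^ 2 / (2 * real N * (real N / 2))"
        using D k by (intro frac_le mult_left_mono) (auto simp: power2_eq_square algebra_simps)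
      then show "x - (real k - 1) / (2 * real N) \<le> real k ^ 2 / real N ^ 2"
        unfolding eq by (simp add: power2_eq_square)
    qed
    have x4: "0 \<le> (1 - p k) * x" "(1 - p k) * x \<le> 2 * real k ^ 3 / real N ^ 2"
    proof -
      show "0 \<le> (1 - p k) * x" using IH x0 by simp
      have "(1 - p k) * x \<le> (real k * real k / real N) * (2 * real k / real N)"
      proof (intro mult_mono)
        have "(real k - 1) * (real k - 2) / real N \<le> real k * real k / real N"
          using D k by (intro divide_right_mono) (auto simp: algebra_simps)
        then show "1 - p k \<le> real k * real k / real N" using IH by linarith
        have "2 * (real k - 1) / real N \<le> 2 * real k / real N"
          using D by (intro divide_right_mono) auto
        then show "x \<le> 2 * real k / real N" using x2 by linarith
      qed (use x0 in auto)
      also have "\<dots> = 2 * real k ^ 3 / real N ^ 2"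
        by (simp add: power2_eq_square power3_eq_cube)
      finally show "(1 - p k) * x \<le> 2 * real k ^ 3 / real N ^ 2" .
    qed
    \<comment> \<open>New error = old error - linearization error of x + cross term. The last two
      cost at most (k^2 + 2 k^3)/N^2, which fits between k^4/N^2 and (k + 1)^4/N^2.\<close>
    have eq: "p (Suc k) - (1 - (real (Suc k) - 1) * (real (Suc k) - 2) / (4 * real N)) =
        (p k - (1 - (real k - 1) * (real k - 2) / (4 * real N))) - (x - (real k - 1) / (2 * real N)) + (1 - p k) * x"
      using D by (simp add: p field_simps)
    have "\<bar>p (Suc k) - (1 - (real (Suc k) - 1) * (real (Suc k) - 2) / (4 * real N))\<bar> \<le>
        real k ^ 4 / real N ^ 2 + real k ^ 2 / real N ^ 2 + 2 * real k ^ 3 / real N ^ 2"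
      unfolding eq using x3 x4 IH(4) by linarith
    also have "\<dots> = (real k ^ 4 + real k ^ 2 + 2 * real k ^ 3) / real N ^ 2"
      by (simp add: add_divide_distrib)
    also have "\<dots> \<le> real (Suc k) ^ 4 / real N ^ 2"
      by (intro divide_right_mono) (auto simp: eval_nat_numeral algebra_simps)
    finally have "\<bar>p (Suc k) - (1 - (real (Suc k) - 1) * (real (Suc k) - 2) / (4 * real N))\<bar> \<le>
       real (Suc k) ^ 4 / real N ^ 2" .
    moreover have "0 \<le> p (Suc k)" "p (Suc k) \<le> 1"
      unfolding p using IH x0 x1 by (auto intro: mult_le_one)
    ultimately show ?case using incr by blast
  qed
  then show ?thesis by blast
qed

text \<open>There is no upper limit on k: beyond N + 1 the coefficient is 0, and the main term
  itself is within the error bound because k >= N. That range is the reason for the additional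
  factor 2.\<close>

lemma T_power_nth_ratio_expansion:
  assumes "k \<ge> 1" "N \<ge> 2"
  shows "\<bar>(T ^ k) $ N / T $ N - 2 * real k / 2 ^ k * (1 - (real k - 1) * (real k - 2) / (4 * real N))\<bar>
     \<le> 4 * real k ^ 5 / 2 ^ k / real N ^ 2"
proof -
  \<comment> \<open>Normalized by its limit 2 k / 2^k, the ratio starts at 1 and satisfies the
    recurrence of \<open>product_expansion\<close>.\<close>
  define p where "p = (\<lambda>k. (T ^ k) $ N / T $ N * 2 ^ k / (2 * real k))"
  have pos: "T $ N > 0" using T_nth_pos assms by simp
  define main where "main = 1 - (real k - 1) * (real k - 2) / (4 * real N)"
  have "\<bar>p k - main\<bar> \<le> 2 * real k ^ 4 / real N ^ 2"
  proof (cases "k \<le> Suc N")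
    case True
    have "\<bar>p k - main\<bar> \<le> real k ^ 4 / real N ^ 2"
      unfolding main_def
    proof (rule product_expansion)
      show "p 1 = 1" using pos by (simp add: p_def)
      fix j assume j: "1 \<le> j" "j \<le> N"
      have cancel: "a / t * (2 * c) / (2 * m) = a / m * c / t"
        and cancel': "a / m * w * c / t = a / t * c / (2 * m) * (2 * w)" for a t c m w :: real
        by (simp_all add: ac_simps)
      have "p (Suc j) = (T ^ Suc j) $ N / real (Suc j) * 2 ^ j / T $ N"
        unfolding p_def power_Suc[of "2::real"] by (rule cancel)
      also have "\<dots> = p j * (2 * ((real N - real j) / (2 * real N - real j - 1)))"
        unfolding T_power_Suc_nth[OF j assms(2)] p_def by (rule cancel')
      also have "2 * ((real N - real j) / (2 * real N - real j - 1)) = 1 - (real j - 1) / (2 * real N - real j - 1)"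
        using j assms by (simp add: field_simps)
      finally show "p (Suc j) = p j * (1 - (real j - 1) / (2 * real N - real j - 1))" .
    qed (use assms True in auto)
    also have "\<dots> \<le> 2 * real k ^ 4 / real N ^ 2"
      by (intro divide_right_mono) auto
    finally show ?thesis .
  next
    case False
    then have kN: "real k \<ge> real N" "real N \<ge> 2" using assms by auto
    have "p k = 0" using False by (simp add: p_def T_power_nth_eq_0)
    have "1 \<le> real k ^ 4 / real N ^ 2"
    proof -
      have "real N ^ 2 \<le> real k ^ 2" using kN by (intro power_mono) auto
      also have "\<dots> \<le> real k ^ 4" using kN by (intro power_increasing) auto
      finally show ?thesis using kN by (simp add: field_simps)
    qed
    moreover have "0 \<le> (real k - 1) * (real k - 2) / (4 * real N)" using kN by simp
    moreover have "(real k - 1) * (real k - 2) / (4 * real N) \<le> real k ^ 4 / real N ^ 2"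
    proof -
      have "(real k - 1) * (real k - 2) / (4 * real N) \<le> real k ^ 2 / real N"
        using kN by (intro frac_le) (auto simp: power2_eq_square algebra_simps)
      also have "\<dots> = real k ^ 2 * real N / real N ^ 2"
        using kN by (simp add: power2_eq_square)
      also have "\<dots> \<le> real k ^ 2 * real k ^ 2 / real N ^ 2"
        using kN by (intro divide_right_mono mult_left_mono) (auto intro: order_trans[OF _ self_le_power])
      finally show ?thesis by (simp flip: power_add)
    qed
    ultimately show ?thesis unfolding \<open>p k = 0\<close> main_def by linarith
  qed
  then have "2 * real k / 2 ^ k * \<bar>p k - main\<bar> \<le> 2 * real k / 2 ^ k * (2 * real k ^ 4 / real N ^ 2)"
    by (intro mult_left_mono) auto
  moreover have "2 * real k / 2 ^ k * \<bar>p k - main\<bar> = \<bar>2 * real k / 2 ^ k * (p k - main)\<bar>"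
    by (simp add: abs_mult)
  moreover have "2 * real k / 2 ^ k * (p k - main) = (T ^ k) $ N / T $ N - 2 * real k / 2 ^ k * main"
    using assms by (simp add: p_def algebra_simps)
  moreover have "2 * real k / 2 ^ k * (2 * real k ^ 4 / real N ^ 2) = 4 * real k ^ 5 / 2 ^ k / real N ^ 2"
    by (simp add: eval_nat_numeral)
  ultimately show ?thesis unfolding main_def by metis
qed

text \<open>Passes from N = n - 1 to n, with n >= 3 giving N >= 2. Replacing 1/N by 1/n costs
  another k^5/(2^k N^2), and N >= n/2 turns 5/N^2 into 20/n^2.\<close>

lemma T_power_nth_ratio_expansion':
  assumes "k \<ge> 1" "n \<ge> 3"
  shows "\<bar>(T ^ k) $ (n - 1) / T $ (n - 1) - 2 * real k / 2 ^ k * (1 - (real k - 1) * (real k - 2) / (4 * real n))\<bar>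
     \<le> 20 * real k ^ 5 / 2 ^ k / real n ^ 2"
proof -
  define N where "N = real (n - 1)"
  define q where "q = (T ^ k) $ (n - 1) / T $ (n - 1)"
  have N: "N = real n - 1" "real n \<ge> 3" using assms by (auto simp: N_def)
  have "\<bar>q - 2 * real k / 2 ^ k * (1 - (real k - 1) * (real k - 2) / (4 * N))\<bar> \<le> 4 * real k ^ 5 / 2 ^ k / N ^ 2"
    using T_power_nth_ratio_expansion[of k "n - 1"] assms by (simp add: N_def q_def)
  moreover have "\<bar>2 * real k / 2 ^ k * (1 - (real k - 1) * (real k - 2) / (4 * N)) -
      2 * real k / 2 ^ k * (1 - (real k - 1) * (real k - 2) / (4 * real n))\<bar> \<le> real k ^ 5 / 2 ^ k / N ^ 2"
  proof -
    have k0: "0 \<le> (real k - 1) * (real k - 2)"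
      using assms by (cases "k = 1") auto
    have "2 * e * (1 - a / (4 * N)) - 2 * e * (1 - a / (4 * real n)) = - (e * a / (2 * (N * real n)))" for e a
    proof -
      have "2 * e * (1 - a / (4 * N)) - 2 * e * (1 - a / (4 * real n)) = - (e * a / 2 * (1 / N - 1 / real n))"
        by (simp add: algebra_simps)
      also have "1 / N - 1 / real n = 1 / (N * real n)"
        using N by (simp add: field_simps)
      finally show ?thesis by simp
    qed
    from this[of "real k / 2 ^ k" "(real k - 1) * (real k - 2)"]
    have "2 * real k / 2 ^ k * (1 - (real k - 1) * (real k - 2) / (4 * N)) -
      2 * real k / 2 ^ k * (1 - (real k - 1) * (real k - 2) / (4 * real n)) =
      - (real k / 2 ^ k * ((real k - 1) * (real k - 2)) / (2 * (N * real n)))"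
      by simp
    then have "\<bar>2 * real k / 2 ^ k * (1 - (real k - 1) * (real k - 2) / (4 * N)) -
      2 * real k / 2 ^ k * (1 - (real k - 1) * (real k - 2) / (4 * real n))\<bar> =
      real k / 2 ^ k * ((real k - 1) * (real k - 2)) / (2 * (N * real n))"
      using N k0 by simp
    also have "\<dots> \<le> real k / 2 ^ k * real k ^ 4 / (N * N)"
    proof (intro frac_le mult_left_mono)
      have "(real k - 1) * (real k - 2) \<le> real k ^ 2"
        using assms by (simp add: power2_eq_square algebra_simps)
      also have "\<dots> \<le> real k ^ 4" using assms by (intro power_increasing) auto
      finally show "(real k - 1) * (real k - 2) \<le> real k ^ 4" .
      have "N * N \<le> N * real n" using N by (intro mult_left_mono) auto
      also have "\<dots> \<le> 2 * (N * real n)" using N by simp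
      finally show "N * N \<le> 2 * (N * real n)" .
    qed (use N in auto)
    also have "\<dots> = real k ^ 5 / 2 ^ k / N ^ 2" by (simp add: eval_nat_numeral)
    finally show ?thesis .
  qed
  moreover have "5 * (real k ^ 5 / 2 ^ k) * (1 / N ^ 2) = 4 * real k ^ 5 / 2 ^ k / N ^ 2 + real k ^ 5 / 2 ^ k / N ^ 2"
    by (simp add: add_divide_distrib[symmetric])
  moreover have tri: "\<bar>q - a\<bar> \<le> x \<Longrightarrow> \<bar>a - b\<bar> \<le> y \<Longrightarrow> z = x + y \<Longrightarrow> \<bar>q - b\<bar> \<le> z" for a b x y z :: real
    by linarith
  ultimately have "\<bar>q - 2 * real k / 2 ^ k * (1 - (real k - 1) * (real k - 2) / (4 * real n))\<bar> \<le>
      5 * (real k ^ 5 / 2 ^ k) * (1 / N ^ 2)" by blast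
  also have "\<dots> \<le> 5 * (real k ^ 5 / 2 ^ k) * (4 / real n ^ 2)"
  proof (intro mult_left_mono)
    have "(real n / 2) ^ 2 \<le> N ^ 2" using N by (intro power_mono) auto
    moreover have "N > 0" using N by simp
    ultimately show "1 / N ^ 2 \<le> 4 / real n ^ 2"
      using N(2) by (simp add: field_simps)
  qed auto
  finally show ?thesis by (simp add: q_def)
qed

section \<open>Closed forms of the alternating coefficient series\<close>

lemma negative_binomial_sums:
  fixes x :: real
  assumes "0 \<le> x" "x < 1"
  shows "(\<lambda>i. (- 1) ^ i * real ((i + p) choose p) * x ^ i) sums (1 / (1 + x) ^ (p + 1))"
proof -
  have "(\<lambda>i. (- real (p + 1) gchoose i) * x ^ i) sums (1 + x) powr (- real (p + 1))"
    using assms by (intro gen_binomial_real) auto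
  moreover have "(- real (p + 1) gchoose i) = (- 1) ^ i * real ((i + p) choose p)" for i
  proof -
    have "(- real (p + 1) gchoose i) = (- 1) ^ i * ((real i + real p) gchoose i)"
      by (subst gbinomial_negated_upper) (simp add: algebra_simps)
    also have "(real i + real p) gchoose i = real ((i + p) choose i)"
      by (simp add: binomial_gbinomial)
    also have "(i + p) choose i = (i + p) choose p"
      using binomial_symmetric[of i "i + p"] by simp
    finally show ?thesis .
  qed
  moreover have "(1 + x) powr (- real (p + 1)) = 1 / (1 + x) ^ (p + 1)"
    using assms by (simp only: powr_minus powr_realpow' divide_inverse)
  ultimately show ?thesis by simp
qed

text \<open>The weights 3 k + 1 and k (k - 1)^2 are those of the combined main terms for k and k +
  1, up to the factor 3/4; k runs through the multiples of s, and x stands for 2^-s.\<close>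

lemma cubic_negative_binomial_sums:
  fixes x s :: real
  assumes "0 \<le> x" "x < 1"
  defines "k \<equiv> \<lambda>i. (real i + 1) * s"
  shows "(\<lambda>i. (- 1) ^ i * (3 * k i + 1) * x ^ (i + 1)) sums (x * (3 * s / (1 + x) ^ 2 + 1 / (1 + x)))" (is ?A)
    and "(\<lambda>i. (- 1) ^ i * (k i * (k i - 1) ^ 2) * x ^ (i + 1)) sums
      (x * (s ^ 3 * (6 / (1 + x) ^ 4 - 6 / (1 + x) ^ 3 + 1 / (1 + x) ^ 2)
        - 2 * s ^ 2 * (2 / (1 + x) ^ 3 - 1 / (1 + x) ^ 2) + s / (1 + x) ^ 2))" (is ?B)
proof -
  have 0: "(\<lambda>i. (- 1) ^ i * x ^ i) sums (1 / (1 + x))"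
    using negative_binomial_sums[OF assms(1,2), of 0] by simp
  have 1: "(\<lambda>i. (- 1) ^ i * (real i + 1) * x ^ i) sums (1 / (1 + x) ^ 2)"
    using negative_binomial_sums[OF assms(1,2), of 1] by (simp add: add.commute numeral_2_eq_2)
  have b2: "real (i + 2 choose 2) = (real i + 1) * (real i + 2) / 2" for i
    by (simp add: binomial_gbinomial gbinomial_prod_rev numeral_eq_Suc field_simps)
  have b3: "real (i + 3 choose 3) = (real i + 1) * (real i + 2) * (real i + 3) / 6" for i
    by (simp add: binomial_gbinomial gbinomial_prod_rev numeral_eq_Suc field_simps)
  have 2: "(\<lambda>i. (- 1) ^ i * ((real i + 1) * (real i + 2) / 2) * x ^ i) sums (1 / (1 + x) ^ 3)"
    using negative_binomial_sums[OF assms(1,2), of 2] unfolding b2 by simp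
  have 3: "(\<lambda>i. (- 1) ^ i * ((real i + 1) * (real i + 2) * (real i + 3) / 6) * x ^ i) sums (1 / (1 + x) ^ 4)"
    using negative_binomial_sums[OF assms(1,2), of 3] unfolding b3 by simp
  have "(\<lambda>i. x * (3 * s * ((- 1) ^ i * (real i + 1) * x ^ i) + (- 1) ^ i * x ^ i)) sums
      (x * (3 * s * (1 / (1 + x) ^ 2) + 1 / (1 + x)))"
    by (intro sums_mult sums_add 0 1)
  then show ?A by (simp add: k_def algebra_simps)
  \<comment> \<open>With u = i + 1, u^3 = 6 C(i + 3, 3) - 6 C(i + 2, 2) + u and u^2 = 2 C(i + 2, 2)
    - u are inserted into k (k - 1)^2 = s^3 u^3 - 2 s^2 u^2 + s u.\<close>
  have lincomb: "(\<lambda>i. x * (s ^ 3 * (6 * ((- 1) ^ i * ((real i + 1) * (real i + 2) * (real i + 3) / 6) * x ^ i)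
         - 6 * ((- 1) ^ i * ((real i + 1) * (real i + 2) / 2) * x ^ i) + (- 1) ^ i * (real i + 1) * x ^ i)
        - 2 * s ^ 2 * (2 * ((- 1) ^ i * ((real i + 1) * (real i + 2) / 2) * x ^ i) - (- 1) ^ i * (real i + 1) * x ^ i)
        + s * ((- 1) ^ i * (real i + 1) * x ^ i))) sums
      (x * (s ^ 3 * (6 * (1 / (1 + x) ^ 4) - 6 * (1 / (1 + x) ^ 3) + 1 / (1 + x) ^ 2)
        - 2 * s ^ 2 * (2 * (1 / (1 + x) ^ 3) - 1 / (1 + x) ^ 2) + s * (1 / (1 + x) ^ 2)))"
    by (intro sums_mult sums_add sums_diff 1 2 3)
  have poly: "x * (s ^ 3 * (6 * ((- 1) ^ i * ((real i + 1) * (real i + 2) * (real i + 3) / 6) * x ^ i)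
         - 6 * ((- 1) ^ i * ((real i + 1) * (real i + 2) / 2) * x ^ i) + (- 1) ^ i * (real i + 1) * x ^ i)
        - 2 * s ^ 2 * (2 * ((- 1) ^ i * ((real i + 1) * (real i + 2) / 2) * x ^ i) - (- 1) ^ i * (real i + 1) * x ^ i)
        + s * ((- 1) ^ i * (real i + 1) * x ^ i)) = (- 1) ^ i * (k i * (k i - 1) ^ 2) * x ^ (i + 1)" for i
  proof -
    have "s ^ 3 * (6 * ((a + 1) * (a + 2) * (a + 3) / 6) - 6 * ((a + 1) * (a + 2) / 2) + (a + 1))
        - 2 * s ^ 2 * (2 * ((a + 1) * (a + 2) / 2) - (a + 1)) + s * (a + 1)
        = ((a + 1) * s) * ((a + 1) * s - 1) ^ 2" for a :: real
      by (simp add: field_simps power2_eq_square power3_eq_cube)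
    from arg_cong[OF this[of "real i"], of "\<lambda>c. (- 1) ^ i * c * x ^ (i + 1)"]
    show ?thesis unfolding k_def by (simp add: algebra_simps)
  qed
  show ?B using lincomb unfolding poly by simp
qed

subsection \<open>Expansion of the tail probabilities of the age\<close>

text \<open>The tail probability will be \<open>age_lead r - age_second r / n\<close> up to order
  n^-2. These are also the summands of \<open>c0\<close> and of \<open>- c1\<close>.\<close>

definition age_lead :: "nat \<Rightarrow> real" where
  "age_lead r = (4 ^ (r + 1) * (3 * real r - 1) + 4) / (4 ^ r + 2)\<^sup>2"

definition age_second :: "nat \<Rightarrow> real" where
  "age_second r = (6 * 64 ^ r * (2 * real r ^ 3 - 5 * real r ^ 2 + 4 * real r - 1)
      - 6 * 16 ^ r * (16 * real r ^ 3 - 24 * real r ^ 2 + 10 * real r - 1)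
      + 24 * 4 ^ r * (2 * real r - 1) * real r ^ 2) / (4 ^ r + 2) ^ 4"

definition prob_age_ge :: "nat \<Rightarrow> nat \<Rightarrow> real" where
  "prob_age_ge n r = measure_pmf.prob (random_cs_tree n) {t. r \<le> age t}"

lemma coeff_sums:
  assumes "r \<ge> 1"
  defines "k \<equiv> \<lambda>i. (i + 1) * (2 * r - 1)"
  shows "(\<lambda>i. (- 1) ^ i * (3 * real (k i) + 1) / 2 ^ k i) sums age_lead r"
    and "(\<lambda>i. (- 1) ^ i * (3 / 4 * (real (k i) * (real (k i) - 1) ^ 2)) / 2 ^ k i) sums age_second r"
proof -
  define s where "s = 2 * real r - 1"
  define x :: real where "x = 1 / 2 ^ (2 * r - 1)"
  define y :: real where "y = 4 ^ r"
  have y: "y > 0" by (simp add: y_def)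
  have "2 * (2::real) ^ (2 * r - 1) = 2 ^ (2 * r)"
    using assms by (subst power_Suc[symmetric]) simp
  then have y_eq: "y = 2 * 2 ^ (2 * r - 1)"
    by (simp add: y_def power_mult)
  have x: "x = 2 / y" unfolding x_def y_eq by simp
  have "x < 1" unfolding x_def using assms by (simp add: one_less_power)
  moreover have "0 \<le> x" by (simp add: x_def)
  ultimately have x01: "0 \<le> x" "x < 1" by auto
  have k: "real (k i) = (real i + 1) * s" for i
  proof -
    have "real (2 * r - 1) = s" using assms(1) by (simp add: s_def of_nat_diff)
    then show ?thesis by (simp only: k_def of_nat_mult of_nat_add of_nat_1)
  qed
  have pow: "x ^ (i + 1) = 1 / 2 ^ k i" for i
    unfolding x_def k_def by (simp only: power_one_over power_mult[symmetric] mult.commute)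
  have y1: "1 + x = (y + 2) / y" using y by (simp add: x field_simps)
  have "x * (3 * s / (1 + x) ^ 2 + 1 / (1 + x)) = age_lead r"
    unfolding y1 age_lead_def power_add y_def[symmetric] x s_def using y
    by (simp add: divide_simps power2_eq_square) (simp add: algebra_simps)
  then show "(\<lambda>i. (- 1) ^ i * (3 * real (k i) + 1) / 2 ^ k i) sums age_lead r"
    using cubic_negative_binomial_sums(1)[OF x01, of s] unfolding pow k by simp
  have y2: "16 ^ r = y ^ 2" "64 ^ r = y ^ 3"
    by (simp_all add: y_def power2_eq_square power3_eq_cube flip: power_mult_distrib)
  have "3 / 4 * (x * (s ^ 3 * (6 / (1 + x) ^ 4 - 6 / (1 + x) ^ 3 + 1 / (1 + x) ^ 2)
        - 2 * s ^ 2 * (2 / (1 + x) ^ 3 - 1 / (1 + x) ^ 2) + s / (1 + x) ^ 2)) = age_second r"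
  proof -
    \<comment> \<open>With 1 + x = z / y everything is brought over z^4, and x = 2 / y cancels one
      power of y; what remains is a polynomial identity in y and r.\<close>
    define z where "z = y + 2"
    have z: "z > 0" "y = z - 2" using y by (auto simp: z_def)
    have e: "6 / (1 + x) ^ 4 - 6 / (1 + x) ^ 3 + 1 / (1 + x) ^ 2 = (6 * y ^ 4 - 6 * y ^ 3 * z + y ^ 2 * z ^ 2) / z ^ 4"
      "2 / (1 + x) ^ 3 - 1 / (1 + x) ^ 2 = (2 * y ^ 3 * z - y ^ 2 * z ^ 2) / z ^ 4"
      "s / (1 + x) ^ 2 = s * y ^ 2 * z ^ 2 / z ^ 4"
      unfolding y1 z_def[symmetric] using y z(1)
      by (simp_all add: power_divide divide_simps eval_nat_numeral) (simp_all add: algebra_simps)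
    have "3 / 4 * (x * (s ^ 3 * (6 / (1 + x) ^ 4 - 6 / (1 + x) ^ 3 + 1 / (1 + x) ^ 2)
        - 2 * s ^ 2 * (2 / (1 + x) ^ 3 - 1 / (1 + x) ^ 2) + s / (1 + x) ^ 2)) =
        3 / 4 * x * (s ^ 3 * (6 * y ^ 4 - 6 * y ^ 3 * z + y ^ 2 * z ^ 2)
          - 2 * s ^ 2 * (2 * y ^ 3 * z - y ^ 2 * z ^ 2) + s * y ^ 2 * z ^ 2) / z ^ 4"
      unfolding e by (simp add: add_divide_distrib diff_divide_distrib algebra_simps)
    also have "3 / 4 * x * (s ^ 3 * (6 * y ^ 4 - 6 * y ^ 3 * z + y ^ 2 * z ^ 2)
          - 2 * s ^ 2 * (2 * y ^ 3 * z - y ^ 2 * z ^ 2) + s * y ^ 2 * z ^ 2) =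
        3 / 2 * (s ^ 3 * (6 * y ^ 3 - 6 * y ^ 2 * z + y * z ^ 2)
          - 2 * s ^ 2 * (2 * y ^ 2 * z - y * z ^ 2) + s * y * z ^ 2)"
      unfolding x using y by (simp add: field_simps eval_nat_numeral)
    also have "\<dots> = 6 * y ^ 3 * (2 * real r ^ 3 - 5 * real r ^ 2 + 4 * real r - 1)
      - 6 * y ^ 2 * (16 * real r ^ 3 - 24 * real r ^ 2 + 10 * real r - 1)
      + 24 * y * (2 * real r - 1) * real r ^ 2"
      unfolding s_def z_def by (simp add: field_simps eval_nat_numeral)
    finally show ?thesis
      unfolding age_second_def y2 y_def[symmetric] z_def .
  qed
  moreover have "(\<lambda>i. 3 / 4 * ((- 1) ^ i * (real (k i) * (real (k i) - 1) ^ 2) * x ^ (i + 1))) sums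
     (3 / 4 * (x * (s ^ 3 * (6 / (1 + x) ^ 4 - 6 / (1 + x) ^ 3 + 1 / (1 + x) ^ 2)
        - 2 * s ^ 2 * (2 / (1 + x) ^ 3 - 1 / (1 + x) ^ 2) + s / (1 + x) ^ 2)))"
    unfolding k by (rule sums_mult[OF cubic_negative_binomial_sums(2)[OF x01]])
  ultimately show "(\<lambda>i. (- 1) ^ i * (3 / 4 * (real (k i) * (real (k i) - 1) ^ 2)) / 2 ^ k i) sums age_second r"
    unfolding pow by (simp add: mult_ac)
qed

lemma cs_trees_finite_nonempty:
  assumes "n \<ge> 2"
  shows "finite {t. catalan_stanley t \<and> num_nodes t = n}" "{t. catalan_stanley t \<and> num_nodes t = n} \<noteq> {}"
proof -
  show "finite {t. catalan_stanley t \<and> num_nodes t = n}" by (rule finite_num_nodes_eq)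
  have "real (card {t. catalan_stanley t \<and> num_nodes t = n}) > 0"
    using card_catalan_stanley[OF assms] T_nth_pos[of "n - 1"] assms by simp
  then show "{t. catalan_stanley t \<and> num_nodes t = n} \<noteq> {}" by (metis card.empty of_nat_0 less_irrefl)
qed

text \<open>Only finitely many terms are nonzero. The infinite form allows termwise comparison with
  the genuinely infinite series of \<open>coeff_sums\<close>.\<close>

lemma prob_age_ge_sums:
  assumes "n \<ge> 2" "r \<ge> 1"
  defines "k \<equiv> \<lambda>i. (i + 1) * (2 * r - 1)"
  shows "(\<lambda>i. (- 1) ^ i * ((T ^ k i) $ (n - 1) / T $ (n - 1) + (T ^ (k i + 1)) $ (n - 1) / T $ (n - 1)))
    sums prob_age_ge n r"
proof -
  have "prob_age_ge n r = real (card ({t. catalan_stanley t \<and> num_nodes t = n} \<inter> {t. r \<le> age t})) / T $ (n - 1)"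
    unfolding prob_age_ge_def random_cs_tree_def card_catalan_stanley[OF assms(1), symmetric]
    by (intro measure_pmf_of_set cs_trees_finite_nonempty assms)
  also have "{t. catalan_stanley t \<and> num_nodes t = n} \<inter> {t. r \<le> age t} =
      {t. catalan_stanley t \<and> num_nodes t = n \<and> r \<le> age t}" by auto
  finally have "prob_age_ge n r =
      (\<Sum>i<Suc n. (- 1) ^ i * ((T ^ k i) $ (n - 1) / T $ (n - 1) + (T ^ (k i + 1)) $ (n - 1) / T $ (n - 1)))"
    unfolding card_age_ge[OF assms(1,2) lessI] sum_divide_distrib k_def
    by (simp only: add_divide_distrib[symmetric] times_divide_eq_right)
  moreover have "(T ^ k i) $ (n - 1) = 0" "(T ^ (k i + 1)) $ (n - 1) = 0" if "i \<notin> {..<Suc n}" for i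
  proof -
    have "(i + 1) * 1 \<le> k i" unfolding k_def using assms(2) by (intro mult_le_mono2) auto
    then show "(T ^ k i) $ (n - 1) = 0" "(T ^ (k i + 1)) $ (n - 1) = 0"
      using that by (auto intro!: T_power_nth_eq_0 simp del: power_Suc)
  qed
  ultimately show ?thesis
    by (simp only:) (intro sums_finite; simp)
qed

text \<open>The constant serves all n and r at once: the error for k = (i + 1)(2 r - 1) is bounded
  by a factor in r times a factor in i, and the latter is summed once and for all in Z.\<close>

lemma prob_age_ge_expansion:
  obtains C :: real where "\<And>n r. n \<ge> 3 \<Longrightarrow> r \<ge> 1 \<Longrightarrow>
    \<bar>prob_age_ge n r - (age_lead r - age_second r / real n)\<bar> \<le> C * (real r ^ 5 / 4 ^ r) / real n ^ 2"
proof -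
  define Z where "Z = (\<Sum>i. (real i + 1) ^ 5 / 2 ^ i)"
  have Z: "summable (\<lambda>i. (real i + 1) ^ 5 / 2 ^ i)"
  proof (rule summable_comparison_test_bigo)
    show "summable (\<lambda>i. norm (inverse (real i ^ 2)))"
      using inverse_power_summable[of 2, where 'a = real] by simp
    show "(\<lambda>i. (real i + 1) ^ 5 / 2 ^ i) \<in> O(\<lambda>i. inverse (real i ^ 2))" by real_asymp
  qed
  show ?thesis
  proof
    fix n r :: nat assume n: "n \<ge> 3" and r: "r \<ge> 1"
    define k where "k = (\<lambda>i. (i + 1) * (2 * r - 1))"
    define q where "q = (\<lambda>k. (T ^ k) $ (n - 1) / T $ (n - 1))"
    define a where "a = (\<lambda>k. 2 * real k / 2 ^ k * (1 - (real k - 1) * (real k - 2) / (4 * real n)))"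
    define d where "d = (\<lambda>i. (- 1) ^ i * (q (k i) + q (k i + 1)) -
       ((- 1) ^ i * (3 * real (k i) + 1) / 2 ^ k i - (- 1) ^ i * (3 / 4 * (real (k i) * (real (k i) - 1) ^ 2)) / 2 ^ k i / real n))"
    have "d sums (prob_age_ge n r - (age_lead r - age_second r / real n))"
      unfolding d_def q_def k_def using n r
      by (intro sums_diff sums_divide prob_age_ge_sums coeff_sums) auto
    then have "\<bar>prob_age_ge n r - (age_lead r - age_second r / real n)\<bar> = norm (suminf d)"
      by (simp add: sums_iff)
    also have "\<dots> \<le> (\<Sum>i. 340 * 64 * (real r ^ 5 / 4 ^ r) / real n ^ 2 * ((real i + 1) ^ 5 / 2 ^ i))"
    proof (rule norm_suminf_le)
      show "summable (\<lambda>i. 340 * 64 * (real r ^ 5 / 4 ^ r) / real n ^ 2 * ((real i + 1) ^ 5 / 2 ^ i))"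
        by (intro summable_mult Z)
      fix i
      have k1: "k i \<ge> 1" using r by (simp add: k_def)
      have "(3 * real (k i) + 1) / 2 ^ k i - (3 / 4 * (real (k i) * (real (k i) - 1) ^ 2)) / 2 ^ k i / real n =
        a (k i) + a (k i + 1)"
        using n by (simp add: a_def field_simps power2_eq_square)
      note a_eq = this
      have "d i = (- 1) ^ i * (q (k i) + q (k i + 1)) - (- 1) ^ i *
         ((3 * real (k i) + 1) / 2 ^ k i - (3 / 4 * (real (k i) * (real (k i) - 1) ^ 2)) / 2 ^ k i / real n)"
        unfolding d_def by (simp add: right_diff_distrib)
      also have "\<dots> = (- 1) ^ i * ((q (k i) - a (k i)) + (q (k i + 1) - a (k i + 1)))"
        unfolding a_eq by (simp add: algebra_simps)
      finally have "norm (d i) = \<bar>(q (k i) - a (k i)) + (q (k i + 1) - a (k i + 1))\<bar>"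
        by (simp add: abs_mult)
      also have "\<dots> \<le> 20 * real (k i) ^ 5 / 2 ^ k i / real n ^ 2 + 20 * real (k i + 1) ^ 5 / 2 ^ (k i + 1) / real n ^ 2"
        using T_power_nth_ratio_expansion'[OF k1 n] T_power_nth_ratio_expansion'[OF _ n, of "k i + 1"]
        unfolding a_def q_def by linarith
      also have "\<dots> \<le> 20 * real (k i) ^ 5 / 2 ^ k i / real n ^ 2 + 20 * (2 * real (k i)) ^ 5 / 2 ^ (k i + 1) / real n ^ 2"
        using k1 by (intro add_left_mono divide_right_mono mult_left_mono power_mono) auto
      \<comment> \<open>340 = 20 (1 + 2^5 / 2). The factor 64 that follows is 2^5 from k <= 2 r (i +
        1), times 2 from 2^k >= 4^r 2^i / 2.\<close>
      also have "\<dots> = 340 * real (k i) ^ 5 / real n ^ 2 / 2 ^ k i"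
        by (simp add: power_mult_distrib field_simps)
      also have "\<dots> \<le> 340 * (2 * real r * (real i + 1)) ^ 5 / real n ^ 2 / (4 ^ r / 2 * 2 ^ i)"
      proof (intro frac_le divide_right_mono mult_left_mono power_mono)
        show "real (k i) \<le> 2 * real r * (real i + 1)"
        proof -
          have "k i \<le> 2 * r * (i + 1)" by (simp add: k_def algebra_simps)
          then have "real (k i) \<le> real (2 * r * (i + 1))" by (rule of_nat_mono)
          then show ?thesis by (simp add: algebra_simps)
        qed
        \<comment> \<open>k = i (2 r - 1) + (2 r - 1) >= i + 2 r - 1 separates the powers of two
          belonging to i and to r.\<close>
        have exponent: "(2::real) ^ (2 * r) \<le> 2 ^ (k i - i + 1)"
        proof (rule power_increasing)
          have "i * 1 \<le> i * (2 * r - 1)" using r by (intro mult_le_mono2) auto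
          moreover have "k i = i * (2 * r - 1) + (2 * r - 1)" by (simp add: k_def)
          moreover have "2 * r = (2 * r - 1) + 1" using r by simp
          ultimately show "2 * r \<le> k i - i + 1" by linarith
        qed simp
        have split: "(2::real) ^ (k i - i + 1) * 2 ^ i = 2 * 2 ^ k i"
        proof -
          have "i * 1 \<le> k i" unfolding k_def using r by (intro mult_le_mono) auto
          then show ?thesis by (simp flip: power_add)
        qed
        have four: "(2::real) ^ (2 * r) = 4 ^ r" by (simp add: power_mult)
        have "(4::real) ^ r * 2 ^ i \<le> 2 ^ (k i - i + 1) * 2 ^ i"
          unfolding four[symmetric] by (intro mult_right_mono exponent) simp
        also note split
        finally have "(4::real) ^ r * 2 ^ i \<le> 2 * 2 ^ k i" .
        then show "(4::real) ^ r / 2 * 2 ^ i \<le> 2 ^ k i" by simp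
      qed (use n in auto)
      also have "\<dots> = 340 * 64 * (real r ^ 5 / 4 ^ r) / real n ^ 2 * ((real i + 1) ^ 5 / 2 ^ i)"
        by (simp add: power_mult_distrib) (simp add: ac_simps)
      finally show "norm (d i) \<le> 340 * 64 * (real r ^ 5 / 4 ^ r) / real n ^ 2 * ((real i + 1) ^ 5 / 2 ^ i)" .
    qed
    also have "\<dots> = (340 * 64 * Z) * (real r ^ 5 / 4 ^ r) / real n ^ 2"
      unfolding suminf_mult[OF Z] Z_def by simp
    finally show "\<bar>prob_age_ge n r - (age_lead r - age_second r / real n)\<bar> \<le>
      (340 * 64 * Z) * (real r ^ 5 / 4 ^ r) / real n ^ 2" .
  qed
qed

subsection \<open>Distribution and moments\<close>

text \<open>One common bound lets both coefficients be summed and truncated by the same lemmas. The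
  constant is dictated by the second one: 156 = 6 * 2 + 6 * 16 + 24 * 2.\<close>

lemma coeff_bounds:
  assumes "r \<ge> 1"
  shows "\<bar>age_lead r\<bar> \<le> 156 * real r ^ 3 / 4 ^ r" "\<bar>age_second r\<bar> \<le> 156 * real r ^ 3 / 4 ^ r"
proof -
  define y :: real where "y = 4 ^ r"
  define R where "R = real r"
  have y: "y \<ge> 1" unfolding y_def by simp
  have R: "R \<ge> 1" using assms by (simp add: R_def)
  have R3: "R \<le> R ^ 3" using R by (intro self_le_power) auto
  have "\<bar>age_lead r\<bar> = (4 * y * (3 * R - 1) + 4) / (y + 2)\<^sup>2"
    using R y by (simp add: age_lead_def y_def R_def)
  also have "\<dots> \<le> 156 * R ^ 3 * y / y\<^sup>2"
  proof (rule frac_le)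
    have "4 * y * (3 * R - 1) + 4 \<le> 12 * R * y" using y by (simp add: algebra_simps)
    also have "\<dots> \<le> 156 * R ^ 3 * y" using y R R3 by (intro mult_right_mono) auto
    finally show "4 * y * (3 * R - 1) + 4 \<le> 156 * R ^ 3 * y" .
    show "y\<^sup>2 \<le> (y + 2)\<^sup>2" using y by (intro power_mono) auto
  qed (use y R in auto)
  also have "\<dots> = 156 * R ^ 3 / y" using y by (simp add: power2_eq_square)
  finally show "\<bar>age_lead r\<bar> \<le> 156 * real r ^ 3 / 4 ^ r" by (simp add: y_def R_def)
  have y2: "16 ^ r = y ^ 2" "64 ^ r = y ^ 3"
    by (simp_all add: y_def power2_eq_square power3_eq_cube flip: power_mult_distrib)
  \<comment> \<open>All three numerator polynomials contain the factor 2 r - 1; in factored form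
    they are visibly nonnegative for r >= 1.\<close>
  define a where "a = (2 * R - 1) * (R - 1) ^ 2"
  define b where "b = (2 * R - 1) * (8 * (R * (R - 1)) + 1)"
  define c where "c = (2 * R - 1) * R ^ 2"
  have a: "0 \<le> a" "a \<le> 2 * R ^ 3"
  proof -
    have "a \<le> (2 * R) * R ^ 2"
      unfolding a_def using R by (intro mult_mono power_mono) auto
    then show "a \<le> 2 * R ^ 3" by (simp add: eval_nat_numeral)
  qed (use R in \<open>auto simp: a_def\<close>)
  have b: "0 \<le> b" "b \<le> 16 * R ^ 3"
  proof -
    have "8 * (R * (R - 1)) + 1 \<le> 8 * R ^ 2" using R by (simp add: algebra_simps power2_eq_square)
    then have "b \<le> (2 * R) * (8 * R ^ 2)"
      unfolding b_def using R by (intro mult_mono) auto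
    then show "b \<le> 16 * R ^ 3" by (simp add: eval_nat_numeral)
  qed (use R in \<open>auto simp: b_def\<close>)
  have c: "0 \<le> c" "c \<le> 2 * R ^ 3"
  proof -
    have "c \<le> (2 * R) * R ^ 2"
      unfolding c_def using R by (intro mult_mono) auto
    then show "c \<le> 2 * R ^ 3" by (simp add: eval_nat_numeral)
  qed (use R in \<open>auto simp: c_def\<close>)
  have "age_second r = (6 * y ^ 3 * a - 6 * y ^ 2 * b + 24 * y * c) / (y + 2) ^ 4"
    unfolding age_second_def y2 y_def[symmetric] R_def[symmetric] a_def b_def c_def
    by (simp add: eval_nat_numeral algebra_simps)
  also have "\<bar>\<dots>\<bar> = \<bar>6 * y ^ 3 * a - 6 * y ^ 2 * b + 24 * y * c\<bar> / (y + 2) ^ 4"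
    using y by simp
  also have "\<dots> \<le> 156 * R ^ 3 * y ^ 3 / y ^ 4"
  proof (rule frac_le)
    have "6 * y ^ 3 * a \<le> 6 * y ^ 3 * (2 * R ^ 3)" using a y by (intro mult_left_mono) auto
    moreover have "6 * y ^ 2 * b \<le> 6 * y ^ 3 * (16 * R ^ 3)"
      using b y by (intro mult_mono power_increasing) auto
    moreover have "24 * y * c \<le> 24 * y ^ 3 * (2 * R ^ 3)"
      using c y by (intro mult_mono self_le_power) auto
    moreover have "0 \<le> 6 * y ^ 3 * a" "0 \<le> 6 * y ^ 2 * b" "0 \<le> 24 * y * c" using a b c y by auto
    ultimately show "\<bar>6 * y ^ 3 * a - 6 * y ^ 2 * b + 24 * y * c\<bar> \<le> 156 * R ^ 3 * y ^ 3"
      unfolding abs_le_iff by (auto simp: algebra_simps)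
    show "y ^ 4 \<le> (y + 2) ^ 4" using y by (intro power_mono) auto
  qed (use y R in auto)
  also have "\<dots> = 156 * R ^ 3 / y" using y by (simp add: eval_nat_numeral)
  finally show "\<bar>age_second r\<bar> \<le> 156 * real r ^ 3 / 4 ^ r" by (simp add: y_def R_def)
qed

text \<open>The constants are unordered sums over r >= 1, while the estimates use ordered series;
  absolute convergence identifies the two.\<close>

lemma infsum_from_one_sums:
  fixes f :: "nat \<Rightarrow> real"
  assumes "summable (\<lambda>i. \<bar>f (Suc i)\<bar>)"
  shows "(\<lambda>i. f (Suc i)) sums (\<Sum>\<^sub>\<infinity>r\<in>{1..}. f r)"
proof -
  have sums: "(\<lambda>i. f (Suc i)) sums (\<Sum>i. f (Suc i))"
    using assms by (intro summable_sums) (rule summable_rabs_cancel)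
  have "((\<lambda>i. f (Suc i)) has_sum (\<Sum>i. f (Suc i))) UNIV"
    using assms sums by (intro norm_summable_imp_has_sum) auto
  then have "(f has_sum (\<Sum>i. f (Suc i))) (Suc ` UNIV)"
    by (subst has_sum_reindex) (auto simp: o_def)
  moreover have "Suc ` UNIV = {1..}"
    by (auto simp: image_iff Suc_le_eq gr0_conv_Suc)
  ultimately show ?thesis using sums by (simp add: infsumI)
qed

text \<open>Exponent 6 is the largest one needed: r^5 from the tail error times the weight of order
  r.\<close>

lemma summable_polynomial_over_4_power:
  assumes "p \<le> 6"
  shows "summable (\<lambda>i. real (Suc i) ^ p / 4 ^ Suc i)"
proof (rule summable_comparison_test')
  show "summable (\<lambda>i. real (Suc i) ^ 6 / 4 ^ Suc i)"
  proof (rule summable_comparison_test_bigo)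
    show "summable (\<lambda>i. norm (inverse (real i ^ 2)))"
      using inverse_power_summable[of 2, where 'a = real] by simp
    show "(\<lambda>i. real (Suc i) ^ 6 / 4 ^ Suc i) \<in> O(\<lambda>i. inverse (real i ^ 2))" by real_asymp
  qed
  fix i :: nat
  have "real (Suc i) ^ p / 4 ^ Suc i \<le> real (Suc i) ^ 6 / 4 ^ Suc i"
    by (intro divide_right_mono power_increasing assms) auto
  then show "norm (real (Suc i) ^ p / 4 ^ Suc i) \<le> real (Suc i) ^ 6 / 4 ^ Suc i" by simp
qed

lemma weighted_bound:
  fixes u v :: real
  assumes "\<bar>u\<bar> \<le> 2 * real r" "\<bar>v\<bar> \<le> D * real r ^ p / 4 ^ r"
  shows "\<bar>u * v\<bar> \<le> 2 * D * real r ^ Suc p / 4 ^ r"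
proof -
  have "\<bar>u * v\<bar> \<le> (2 * real r) * (D * real r ^ p / 4 ^ r)"
    unfolding abs_mult using assms by (intro mult_mono) auto
  then show ?thesis by (simp add: ac_simps)
qed

lemma weighted_coeff_sums:
  fixes w f :: "nat \<Rightarrow> real"
  assumes w: "\<And>r. r \<ge> 1 \<Longrightarrow> \<bar>w r\<bar> \<le> 2 * real r"
    and f: "\<And>r. r \<ge> 1 \<Longrightarrow> \<bar>f r\<bar> \<le> 156 * real r ^ 3 / 4 ^ r"
  shows "(\<lambda>i. w (Suc i) * f (Suc i)) sums (\<Sum>\<^sub>\<infinity>r\<in>{1..}. w r * f r)"
proof (rule infsum_from_one_sums, rule summable_comparison_test')
  show "summable (\<lambda>i. 312 * (real (Suc i) ^ 4 / 4 ^ Suc i))"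
    by (intro summable_mult summable_polynomial_over_4_power) simp
  fix i
  show "norm \<bar>w (Suc i) * f (Suc i)\<bar> \<le> 312 * (real (Suc i) ^ 4 / 4 ^ Suc i)"
    using weighted_bound[OF w[of "Suc i"] f[of "Suc i"]] by simp
qed

text \<open>Applied with w = 1 for the mean and w r = 2 r - 1 for the second moment. As no tree of
  size n has age above n, the finite sum is a full series and can be subtracted termwise from the
  series of the coefficients.\<close>

lemma weighted_tail_sum_expansion:
  fixes w :: "nat \<Rightarrow> real"
  assumes w: "\<And>r. r \<ge> 1 \<Longrightarrow> \<bar>w r\<bar> \<le> 2 * real r"
  obtains K where "\<And>n. n \<ge> 3 \<Longrightarrow> \<bar>(\<Sum>r=1..n. w r * prob_age_ge n r) -
    ((\<Sum>\<^sub>\<infinity>r\<in>{1..}. w r * age_lead r) - (\<Sum>\<^sub>\<infinity>r\<in>{1..}. w r * age_second r) / real n)\<bar> \<le> K / real n ^ 2"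
proof -
  obtain C where C: "\<And>n r. n \<ge> 3 \<Longrightarrow> r \<ge> 1 \<Longrightarrow>
    \<bar>prob_age_ge n r - (age_lead r - age_second r / real n)\<bar> \<le> C * (real r ^ 5 / 4 ^ r) / real n ^ 2"
    using prob_age_ge_expansion by blast
  define Z where "Z = (\<Sum>i. real (Suc i) ^ 6 / 4 ^ Suc i)"
  show ?thesis
  proof
    fix n :: nat assume n: "n \<ge> 3"
    have "prob_age_ge n r = 0" if "r > n" for r
    proof -
      have "set_pmf (random_cs_tree n) = {t. catalan_stanley t \<and> num_nodes t = n}"
        unfolding random_cs_tree_def using n by (intro set_pmf_of_set cs_trees_finite_nonempty) auto
      then have "set_pmf (random_cs_tree n) \<inter> {t. r \<le> age t} = {}"
        using that age_le_num_nodes by fastforce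
      then show ?thesis unfolding prob_age_ge_def by (simp add: measure_pmf_zero_iff)
    qed
    then have "(\<lambda>i. w (Suc i) * prob_age_ge n (Suc i)) sums (\<Sum>i<n. w (Suc i) * prob_age_ge n (Suc i))"
      by (intro sums_finite) auto
    also have "(\<Sum>i<n. w (Suc i) * prob_age_ge n (Suc i)) = (\<Sum>r=1..n. w r * prob_age_ge n r)"
      by (simp add: sum.atLeast1_atMost_eq)
    finally have "(\<lambda>i. w (Suc i) * prob_age_ge n (Suc i) - (w (Suc i) * age_lead (Suc i) - w (Suc i) * age_second (Suc i) / real n)) sums
      ((\<Sum>r=1..n. w r * prob_age_ge n r) -
        ((\<Sum>\<^sub>\<infinity>r\<in>{1..}. w r * age_lead r) - (\<Sum>\<^sub>\<infinity>r\<in>{1..}. w r * age_second r) / real n))" (is "?d sums ?D")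
      by (intro sums_diff sums_divide weighted_coeff_sums w coeff_bounds)
    then have "\<bar>?D\<bar> = norm (suminf ?d)" by (simp add: sums_iff)
    also have "\<dots> \<le> (\<Sum>i. 2 * C / real n ^ 2 * (real (Suc i) ^ 6 / 4 ^ Suc i))"
    proof (rule norm_suminf_le)
      show "summable (\<lambda>i. 2 * C / real n ^ 2 * (real (Suc i) ^ 6 / 4 ^ Suc i))"
        by (intro summable_mult summable_polynomial_over_4_power) simp
      fix i
      have "\<bar>prob_age_ge n (Suc i) - (age_lead (Suc i) - age_second (Suc i) / real n)\<bar> \<le>
        C / real n ^ 2 * real (Suc i) ^ 5 / 4 ^ Suc i"
        using C[OF n, of "Suc i"] by (simp add: ac_simps)
      from weighted_bound[OF w[of "Suc i"] this]
      have "\<bar>w (Suc i) * (prob_age_ge n (Suc i) - (age_lead (Suc i) - age_second (Suc i) / real n))\<bar> \<le>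
        2 * C / real n ^ 2 * (real (Suc i) ^ 6 / 4 ^ Suc i)" by simp
      then show "norm (?d i) \<le> 2 * C / real n ^ 2 * (real (Suc i) ^ 6 / 4 ^ Suc i)"
        by (simp add: algebra_simps)
    qed
    also have "\<dots> = 2 * C * Z / real n ^ 2"
      unfolding suminf_mult[OF summable_polynomial_over_4_power[OF order_refl]] Z_def by simp
    finally show "\<bar>?D\<bar> \<le> 2 * C * Z / real n ^ 2" .
  qed
qed

section \<open>From tail probabilities to the distribution, mean and variance\<close>

text \<open>Summation by parts: interchanging the sums over trees and over r replaces the condition
  r <= age t by a tail probability.\<close>

lemma expectation_age_sum:
  fixes w :: "nat \<Rightarrow> real"
  assumes "n \<ge> 2"
  shows "measure_pmf.expectation (random_cs_tree n) (\<lambda>t. \<Sum>r=1..age t. w r) = (\<Sum>r=1..n. w r * prob_age_ge n r)"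
proof -
  define S where "S = {t. catalan_stanley t \<and> num_nodes t = n}"
  have S: "finite S" "S \<noteq> {}" using cs_trees_finite_nonempty[OF assms] by (auto simp: S_def)
  have "measure_pmf.expectation (random_cs_tree n) (\<lambda>t. \<Sum>r=1..age t. w r) =
      (\<Sum>t\<in>S. \<Sum>r=1..age t. w r) / real (card S)"
    unfolding random_cs_tree_def S_def[symmetric] by (rule integral_pmf_of_set[OF S(2,1)])
  also have "(\<Sum>t\<in>S. \<Sum>r=1..age t. w r) = (\<Sum>t\<in>S. \<Sum>r=1..n. w r * of_bool (r \<le> age t))"
  proof (rule sum.cong[OF refl])
    fix t assume "t \<in> S"
    then have "age t \<le> n" using age_le_num_nodes by (auto simp: S_def)
    then have "{1..age t} = {1..n} \<inter> {r. r \<le> age t}" by auto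
    then show "(\<Sum>r=1..age t. w r) = (\<Sum>r=1..n. w r * of_bool (r \<le> age t))"
      by (simp add: sum.inter_restrict of_bool_def if_distrib cong: if_cong)
  qed
  also have "\<dots> = (\<Sum>r=1..n. w r * real (card (S \<inter> {t. r \<le> age t})))"
    using S by (subst sum.swap) (simp add: sum_distrib_left[symmetric] sum_of_bool_eq)
  also have "\<dots> / real (card S) = (\<Sum>r=1..n. w r * prob_age_ge n r)"
    unfolding prob_age_ge_def random_cs_tree_def S_def[symmetric] sum_divide_distrib
    by (simp add: measure_pmf_of_set[OF S(2,1)])
  finally show ?thesis .
qed

lemma age_distribution_expansion:
  obtains C :: real where "\<And>n r. n \<ge> 3 \<Longrightarrow> r \<ge> 1 \<Longrightarrow>
    \<bar>measure_pmf.prob (random_cs_tree n) {t. age t = r} -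
      ((age_lead r - age_lead (r + 1)) - (age_second r - age_second (r + 1)) / real n)\<bar>
    \<le> C * (real r ^ 5 / 3 ^ r / real n ^ 2)"
proof -
  obtain C where C: "\<And>n r. n \<ge> 3 \<Longrightarrow> r \<ge> 1 \<Longrightarrow>
    \<bar>prob_age_ge n r - (age_lead r - age_second r / real n)\<bar> \<le> C * (real r ^ 5 / 4 ^ r) / real n ^ 2"
    using prob_age_ge_expansion by blast
  show ?thesis
  proof
    fix n r :: nat assume n: "n \<ge> 3" and r: "r \<ge> 1"
    let ?M = "random_cs_tree n"
    have "{t. r \<le> age t} = {t. age t = r} \<union> {t. r + 1 \<le> age t}" by auto
    then have "prob_age_ge n r = measure_pmf.prob ?M {t. age t = r} + prob_age_ge n (r + 1)"
      unfolding prob_age_ge_def by (simp only:) (rule measure_pmf.finite_measure_Union; auto)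
    then have "\<bar>measure_pmf.prob ?M {t. age t = r} -
      ((age_lead r - age_lead (r + 1)) - (age_second r - age_second (r + 1)) / real n)\<bar> \<le>
      \<bar>prob_age_ge n r - (age_lead r - age_second r / real n)\<bar> +
      \<bar>prob_age_ge n (r + 1) - (age_lead (r + 1) - age_second (r + 1) / real n)\<bar>"
      unfolding diff_divide_distrib by linarith
    also have "\<dots> \<le> C * (real r ^ 5 / 4 ^ r) / real n ^ 2 + C * (real (r + 1) ^ 5 / 4 ^ (r + 1)) / real n ^ 2"
      using n r by (intro add_mono C) auto
    also have "\<dots> = C * ((real r ^ 5 / 4 ^ r + real (r + 1) ^ 5 / 4 ^ (r + 1)) / real n ^ 2)"
      by (simp add: algebra_simps add_divide_distrib)
    \<comment> \<open>9 = 1 + 2^5 / 4, from r + 1 <= 2 r. The absolute value is taken because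
      nothing is known about the sign of C.\<close>
    also have "\<dots> \<le> \<bar>C\<bar> * (9 * (real r ^ 5 / 3 ^ r) / real n ^ 2)"
    proof (intro mult_mono divide_right_mono)
      have "real (r + 1) ^ 5 / 4 ^ (r + 1) \<le> (2 * real r) ^ 5 / 4 ^ (r + 1)"
        using r by (intro divide_right_mono power_mono) auto
      then have "real r ^ 5 / 4 ^ r + real (r + 1) ^ 5 / 4 ^ (r + 1) \<le> 9 * (real r ^ 5 / 4 ^ r)"
        by (simp add: power_mult_distrib)
      also have "\<dots> \<le> 9 * (real r ^ 5 / 3 ^ r)"
        by (intro mult_left_mono divide_left_mono power_mono) auto
      finally show "real r ^ 5 / 4 ^ r + real (r + 1) ^ 5 / 4 ^ (r + 1) \<le> 9 * (real r ^ 5 / 3 ^ r)" .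
    qed auto
    also have "\<dots> = (9 * \<bar>C\<bar>) * (real r ^ 5 / 3 ^ r / real n ^ 2)" by simp
    finally show "\<bar>measure_pmf.prob ?M {t. age t = r} -
      ((age_lead r - age_lead (r + 1)) - (age_second r - age_second (r + 1)) / real n)\<bar>
      \<le> (9 * \<bar>C\<bar>) * (real r ^ 5 / 3 ^ r / real n ^ 2)" .
  qed
qed

lemma c_eqs:
  "c0 = (\<Sum>\<^sub>\<infinity>r\<in>{1..}. age_lead r)"
  "c1 = - (\<Sum>\<^sub>\<infinity>r\<in>{1..}. age_second r)"
  "c2 = (\<Sum>\<^sub>\<infinity>r\<in>{1..}. (2 * real r - 1) * age_lead r) - c0\<^sup>2"
  "c3 = - (\<Sum>\<^sub>\<infinity>r\<in>{1..}. (2 * real r - 1) * age_second r) - 2 * c0 * c1"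
  unfolding c0_def c1_def c2_def c3_def age_lead_def age_second_def
  by (simp_all only: times_divide_eq_left times_divide_eq_right)

lemma expectation_age_expansion:
  obtains K where "\<And>n. n \<ge> 3 \<Longrightarrow>
    \<bar>measure_pmf.expectation (random_cs_tree n) (\<lambda>t. real (age t)) - (c0 + c1 / real n)\<bar> \<le> K / real n ^ 2"
proof -
  obtain K where K: "\<And>n. n \<ge> 3 \<Longrightarrow> \<bar>(\<Sum>r=1..n. 1 * prob_age_ge n r) -
    ((\<Sum>\<^sub>\<infinity>r\<in>{1..}. 1 * age_lead r) - (\<Sum>\<^sub>\<infinity>r\<in>{1..}. 1 * age_second r) / real n)\<bar> \<le> K / real n ^ 2"
    using weighted_tail_sum_expansion[of "\<lambda>_. 1"] by auto
  show ?thesis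
  proof
    fix n :: nat assume n: "n \<ge> 3"
    have "measure_pmf.expectation (random_cs_tree n) (\<lambda>t. real (age t)) = (\<Sum>r=1..n. 1 * prob_age_ge n r)"
      using n expectation_age_sum[of n "\<lambda>_. 1"] by simp
    then show "\<bar>measure_pmf.expectation (random_cs_tree n) (\<lambda>t. real (age t)) - (c0 + c1 / real n)\<bar> \<le> K / real n ^ 2"
      using K[OF n] by (simp add: c_eqs)
  qed
qed

text \<open>The first m odd numbers add up to m^2. Adding c0^2 and 2 c0 c1 back undoes the
  subtractions built into \<open>c2\<close> and \<open>c3\<close>.\<close>

lemma second_moment_age_expansion:
  obtains K where "\<And>n. n \<ge> 3 \<Longrightarrow>
    \<bar>measure_pmf.expectation (random_cs_tree n) (\<lambda>t. (real (age t))\<^sup>2) - ((c2 + c0\<^sup>2) + (c3 + 2 * c0 * c1) / real n)\<bar> \<le> K / real n ^ 2"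
proof -
  obtain K where K: "\<And>n. n \<ge> 3 \<Longrightarrow> \<bar>(\<Sum>r=1..n. (2 * real r - 1) * prob_age_ge n r) -
    ((\<Sum>\<^sub>\<infinity>r\<in>{1..}. (2 * real r - 1) * age_lead r) - (\<Sum>\<^sub>\<infinity>r\<in>{1..}. (2 * real r - 1) * age_second r) / real n)\<bar> \<le> K / real n ^ 2"
    using weighted_tail_sum_expansion[of "\<lambda>r. 2 * real r - 1"] by auto
  have square: "(\<Sum>r=1..m. 2 * real r - 1) = (real m)\<^sup>2" for m
    by (induction m) (auto simp: power2_eq_square algebra_simps)
  show ?thesis
  proof
    fix n :: nat assume n: "n \<ge> 3"
    have "measure_pmf.expectation (random_cs_tree n) (\<lambda>t. (real (age t))\<^sup>2) = (\<Sum>r=1..n. (2 * real r - 1) * prob_age_ge n r)"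
      using n expectation_age_sum[of n "\<lambda>r. 2 * real r - 1"] unfolding square by simp
    then show "\<bar>measure_pmf.expectation (random_cs_tree n) (\<lambda>t. (real (age t))\<^sup>2) - ((c2 + c0\<^sup>2) + (c3 + 2 * c0 * c1) / real n)\<bar> \<le> K / real n ^ 2"
      using K[OF n] unfolding c_eqs(3,4) by (simp add: algebra_simps)
  qed
qed

lemma variance_age_expansion:
  obtains K where "\<And>n. n \<ge> 3 \<Longrightarrow>
    \<bar>measure_pmf.variance (random_cs_tree n) (\<lambda>t. real (age t)) - (c2 + c3 / real n)\<bar> \<le> K / real n ^ 2"
proof -
  obtain K1 where K1: "\<And>n. n \<ge> 3 \<Longrightarrow>
    \<bar>measure_pmf.expectation (random_cs_tree n) (\<lambda>t. real (age t)) - (c0 + c1 / real n)\<bar> \<le> K1 / real n ^ 2"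
    using expectation_age_expansion by blast
  obtain K2 where K2: "\<And>n. n \<ge> 3 \<Longrightarrow>
    \<bar>measure_pmf.expectation (random_cs_tree n) (\<lambda>t. (real (age t))\<^sup>2) - ((c2 + c0\<^sup>2) + (c3 + 2 * c0 * c1) / real n)\<bar> \<le> K2 / real n ^ 2"
    using second_moment_age_expansion by blast
  show ?thesis
  proof
    fix n :: nat assume n: "n \<ge> 3"
    let ?M = "random_cs_tree n"
    define e1 where "e1 = measure_pmf.expectation ?M (\<lambda>t. real (age t)) - (c0 + c1 / real n)"
    define e2 where "e2 = measure_pmf.expectation ?M (\<lambda>t. (real (age t))\<^sup>2) - ((c2 + c0\<^sup>2) + (c3 + 2 * c0 * c1) / real n)"
    have e: "\<bar>e1\<bar> \<le> K1 / real n ^ 2" "\<bar>e2\<bar> \<le> K2 / real n ^ 2"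
      using K1[OF n] K2[OF n] by (auto simp: e1_def e2_def)
    have n1: "1 \<le> real n ^ 2" "1 \<le> real n" using n by auto
    have K10: "K1 \<ge> 0"
    proof -
      have "0 \<le> K1 / real n ^ 2" using e(1) by linarith
      then show ?thesis using n1 by (simp add: zero_le_divide_iff)
    qed
    have "finite (set_pmf ?M)"
      unfolding random_cs_tree_def using n cs_trees_finite_nonempty[of n] by simp
    then have "measure_pmf.variance ?M (\<lambda>t. real (age t)) =
        measure_pmf.expectation ?M (\<lambda>t. (real (age t))\<^sup>2) - (measure_pmf.expectation ?M (\<lambda>t. real (age t)))\<^sup>2"
      by (intro measure_pmf.variance_eq integrable_measure_pmf_finite)
    also have "\<dots> = ((c2 + c0\<^sup>2) + (c3 + 2 * c0 * c1) / real n + e2) - (c0 + c1 / real n + e1)\<^sup>2"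
      by (simp add: e1_def e2_def)
    \<comment> \<open>The terms of order 1 and 1/n of the squared mean cancel; each remaining term
      contains e1, e2 or c1^2/n^2.\<close>
    also have "\<dots> - (c2 + c3 / real n) = e2 - c1\<^sup>2 / real n ^ 2 - e1 * (2 * c0 + 2 * (c1 / real n) + e1)"
      using n by (simp add: field_simps power2_eq_square)
    also have "\<bar>\<dots>\<bar> \<le> \<bar>e2\<bar> + c1\<^sup>2 / real n ^ 2 + \<bar>e1\<bar> * (2 * \<bar>c0\<bar> + 2 * \<bar>c1\<bar> + K1)"
    proof -
      have "\<bar>e1 * (2 * c0 + 2 * (c1 / real n) + e1)\<bar> \<le> \<bar>e1\<bar> * (2 * \<bar>c0\<bar> + 2 * \<bar>c1\<bar> + K1)"
        unfolding abs_mult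
      proof (intro mult_left_mono)
        have "\<bar>c1 / real n\<bar> \<le> \<bar>c1\<bar>" using n1 by (simp add: divide_le_eq mult_left_le_one_le mult_le_cancel_left1)
        moreover have "\<bar>e1\<bar> \<le> K1"
        proof -
          have "K1 / real n ^ 2 \<le> K1 / 1" using n1 K10 by (intro divide_left_mono) auto
          then show ?thesis using e(1) by simp
        qed
        ultimately show "\<bar>2 * c0 + 2 * (c1 / real n) + e1\<bar> \<le> 2 * \<bar>c0\<bar> + 2 * \<bar>c1\<bar> + K1" by linarith
      qed simp
      moreover have "0 \<le> c1\<^sup>2 / real n ^ 2" by simp
      ultimately show ?thesis by linarith
    qed
    also have "\<dots> \<le> K2 / real n ^ 2 + c1\<^sup>2 / real n ^ 2 + K1 / real n ^ 2 * (2 * \<bar>c0\<bar> + 2 * \<bar>c1\<bar> + K1)"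
      using e K10 by (intro add_mono mult_right_mono) auto
    also have "\<dots> = (K2 + c1\<^sup>2 + K1 * (2 * \<bar>c0\<bar> + 2 * \<bar>c1\<bar> + K1)) / real n ^ 2"
      by (simp add: add_divide_distrib)
    finally show "\<bar>measure_pmf.variance ?M (\<lambda>t. real (age t)) - (c2 + c3 / real n)\<bar> \<le>
      (K2 + c1\<^sup>2 + K1 * (2 * \<bar>c0\<bar> + 2 * \<bar>c1\<bar> + K1)) / real n ^ 2" .
  qed
qed

lemma bigo_inverse_squareI:
  fixes f :: "nat \<Rightarrow> real"
  assumes "\<And>n. n \<ge> 3 \<Longrightarrow> \<bar>f n\<bar> \<le> K / real n ^ 2"
  shows "f \<in> O(\<lambda>n. 1 / real n ^ 2)"
proof (rule bigoI)
  show "\<forall>\<^sub>F n in sequentially. norm (f n) \<le> K * norm (1 / real n ^ 2)"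
    using eventually_ge_at_top[of 3] by eventually_elim (use assms in simp)
qed

subsection \<open>Numerical values of the constants\<close>

text \<open>Turns r^4/4^r into the geometric 3^-r in the truncated tails. The step works since
  (58/57)^4 < 4/3.\<close>

lemma power4_le_power_4_3: "57 \<le> r \<Longrightarrow> real r ^ 4 \<le> (4 / 3) ^ r"
proof (induction r rule: dec_induct)
  case base
  show ?case by (simp add: power_divide)
next
  case (step r)
  have "real (Suc r) ^ 4 \<le> (58 / 57 * real r) ^ 4"
    using step by (intro power_mono) auto
  also have "\<dots> = (58 / 57) ^ 4 * real r ^ 4" by (rule power_mult_distrib)
  also have "\<dots> \<le> 4 / 3 * (4 / 3) ^ r"
    using step by (intro mult_mono) (auto simp: power_divide)
  finally show ?case by simp
qed

text \<open>The tail from r = 61 on is at most 312/3^61 * 3/2, below 10^-26; 312 is 2 * 156 from the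
  bounds on weight and coefficient.\<close>

lemma truncation_error:
  fixes w f :: "nat \<Rightarrow> real"
  assumes w: "\<And>r. r \<ge> 1 \<Longrightarrow> \<bar>w r\<bar> \<le> 2 * real r"
    and f: "\<And>r. r \<ge> 1 \<Longrightarrow> \<bar>f r\<bar> \<le> 156 * real r ^ 3 / 4 ^ r"
  shows "\<bar>(\<Sum>\<^sub>\<infinity>r\<in>{1..}. w r * f r) - (\<Sum>r=1..60. w r * f r)\<bar> \<le> 1 / 10 ^ 26"
proof -
  have geom: "(\<lambda>i::nat. 312 / 3 ^ 61 * (1 / 3) ^ i) sums (312 / 3 ^ 61 * (1 / (1 - 1 / 3 :: real)))"
    by (intro sums_mult geometric_sums) auto
  have "(\<lambda>i. w (Suc (i + 60)) * f (Suc (i + 60))) sums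
      ((\<Sum>\<^sub>\<infinity>r\<in>{1..}. w r * f r) - (\<Sum>i<60. w (Suc i) * f (Suc i)))"
    by (intro sums_split_initial_segment weighted_coeff_sums w f)
  then have "\<bar>(\<Sum>\<^sub>\<infinity>r\<in>{1..}. w r * f r) - (\<Sum>i<60. w (Suc i) * f (Suc i))\<bar> =
      norm (\<Sum>i. w (Suc (i + 60)) * f (Suc (i + 60)))"
    by (simp add: sums_iff)
  also have "\<dots> \<le> (\<Sum>i. 312 / 3 ^ 61 * (1 / 3) ^ i)"
  proof (rule norm_suminf_le)
    show "summable (\<lambda>i. 312 / 3 ^ 61 * (1 / 3 :: real) ^ i)" using geom by (rule sums_summable)
    fix i :: nat
    define r :: nat where "r = i + 61"
    have "norm (w r * f r) \<le> 312 * real r ^ 4 / 4 ^ r"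
      using weighted_bound[OF w[of r] f[of r]] by (simp add: r_def)
    also have "\<dots> \<le> 312 * (4 / 3) ^ r / 4 ^ r"
      by (intro divide_right_mono mult_left_mono power4_le_power_4_3) (auto simp: r_def)
    also have "\<dots> = 312 / 3 ^ r" by (simp add: power_divide)
    also have "\<dots> = 312 / 3 ^ 61 * (1 / 3) ^ i"
      by (simp only: r_def power_add power_one_over) simp
    also have "r = Suc (i + 60)" by (simp add: r_def)
    finally show "norm (w (Suc (i + 60)) * f (Suc (i + 60))) \<le> 312 / 3 ^ 61 * (1 / 3) ^ i" .
  qed
  also have "\<dots> = 312 / 3 ^ 61 * (1 / (1 - 1 / 3))" using geom by (rule sums_unique[symmetric])
  also have "\<dots> \<le> 1 / 10 ^ 26" by simp
  also have "(\<Sum>i<60. w (Suc i) * f (Suc i)) = (\<Sum>r=1..60::nat. w r * f r)"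
    using sum.atLeast1_atMost_eq[of "\<lambda>r. w r * f r" 60] by simp
  finally show ?thesis .
qed

text \<open>Rounding each fraction down to a multiple of 1/S costs less than one unit per term,
  hence \<open>sum w A\<close> units in total. Only integer divisions have to be evaluated, and no
  common denominator is formed.\<close>

lemma fixed_point_sum_bounds:
  fixes w p q :: "nat \<Rightarrow> int" and S :: int
  assumes "S > 0" "\<And>r. r \<in> A \<Longrightarrow> w r \<ge> 0" "\<And>r. r \<in> A \<Longrightarrow> q r > 0"
  defines "a \<equiv> \<Sum>r\<in>A. w r * ((S * p r) div q r)"
  shows "real_of_int a / real_of_int S \<le> (\<Sum>r\<in>A. real_of_int (w r) * (real_of_int (p r) / real_of_int (q r)))"
    and "(\<Sum>r\<in>A. real_of_int (w r) * (real_of_int (p r) / real_of_int (q r))) \<le> real_of_int (a + sum w A) / real_of_int S"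
proof -
  have *: "real_of_int ((S * p r) div q r) \<le> real_of_int S * (real_of_int (p r) / real_of_int (q r))"
    "real_of_int S * (real_of_int (p r) / real_of_int (q r)) \<le> real_of_int ((S * p r) div q r) + 1" if "r \<in> A" for r
    using assms(3)[OF that] real_of_int_div4[of "S * p r" "q r"] real_of_int_div3[of "S * p r" "q r"]
    by (auto simp: algebra_simps)
  have "real_of_int a \<le> (\<Sum>r\<in>A. real_of_int (w r) * (real_of_int S * (real_of_int (p r) / real_of_int (q r))))"
    unfolding a_def of_int_sum of_int_mult[of "w _"] using assms(2) *(1)
    by (intro sum_mono mult_left_mono) auto
  also have "\<dots> = real_of_int S * (\<Sum>r\<in>A. real_of_int (w r) * (real_of_int (p r) / real_of_int (q r)))"
    by (simp add: sum_distrib_left ac_simps)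
  finally show "real_of_int a / real_of_int S \<le> (\<Sum>r\<in>A. real_of_int (w r) * (real_of_int (p r) / real_of_int (q r)))"
    using assms(1) by (simp add: divide_le_eq mult.commute)
  have "real_of_int S * (\<Sum>r\<in>A. real_of_int (w r) * (real_of_int (p r) / real_of_int (q r))) =
      (\<Sum>r\<in>A. real_of_int (w r) * (real_of_int S * (real_of_int (p r) / real_of_int (q r))))"
    by (simp add: sum_distrib_left ac_simps)
  also have "\<dots> \<le> (\<Sum>r\<in>A. real_of_int (w r) * (real_of_int ((S * p r) div q r) + 1))"
    using assms(2) *(2) by (intro sum_mono mult_left_mono) auto
  also have "\<dots> = real_of_int (a + sum w A)"
    by (simp add: a_def algebra_simps sum.distrib)
  finally show "(\<Sum>r\<in>A. real_of_int (w r) * (real_of_int (p r) / real_of_int (q r))) \<le> real_of_int (a + sum w A) / real_of_int S"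
    using assms(1) by (simp add: le_divide_eq mult.commute)
qed

definition lead_num :: "nat \<Rightarrow> int" where
  "lead_num r = 4 ^ (r + 1) * (3 * int r - 1) + 4"

definition second_num :: "nat \<Rightarrow> int" where
  "second_num r = 6 * 64 ^ r * (2 * int r ^ 3 - 5 * int r ^ 2 + 4 * int r - 1)
      - 6 * 16 ^ r * (16 * int r ^ 3 - 24 * int r ^ 2 + 10 * int r - 1)
      + 24 * 4 ^ r * (2 * int r - 1) * int r ^ 2"

lemma age_lead_eq: "age_lead r = real_of_int (lead_num r) / real_of_int ((4 ^ r + 2) ^ 2)"
  by (simp add: age_lead_def lead_num_def)

lemma age_second_eq: "age_second r = real_of_int (second_num r) / real_of_int ((4 ^ r + 2) ^ 4)"
  by (simp add: age_second_def second_num_def)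

lemma sum_1_60: "(\<Sum>r=1..60. f r) = (\<Sum>r\<leftarrow>[1..<61]. f r)" for f :: "nat \<Rightarrow> int"
proof -
  have "{1..60} = {1..<61::nat}" by auto
  then show ?thesis by (simp only: interv_sum_list_conv_sum_set_nat set_upt)
qed

text \<open>
  With 60 terms rounded down to multiples of \<open>10\<^sup>-\<^sup>2\<^sup>8\<close>, rounding (at most 3600 units) and
  truncation together stay below \<open>10\<^sup>-\<^sup>2\<^sup>4\<close>.
\<close>

lemma lead_floor_sum:
  "(\<Sum>r\<leftarrow>[1..<61]. 1 * ((10 ^ 28 * lead_num r) div (4 ^ r + 2) ^ 2)) = 27182536428679528526648361902"
  by code_simp

lemma weighted_lead_floor_sum:
  "(\<Sum>r\<leftarrow>[1..<61]. (2 * int r - 1) * ((10 ^ 28 * lead_num r) div (4 ^ r + 2) ^ 2)) = 83073589091086441440122742600"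
  by code_simp

lemma second_floor_sum:
  "(\<Sum>r\<leftarrow>[1..<61]. 1 * ((10 ^ 28 * second_num r) div (4 ^ r + 2) ^ 4)) = 42220971510158840823821873450"
  by code_simp

lemma weighted_second_floor_sum:
  "(\<Sum>r\<leftarrow>[1..<61]. (2 * int r - 1) * ((10 ^ 28 * second_num r) div (4 ^ r + 2) ^ 4)) = 321156372426662918461662896370"
  by code_simp

lemma infsum_fixed_point_bounds:
  fixes w p q :: "nat \<Rightarrow> int" and v :: int
  assumes w: "\<And>r. r \<ge> 1 \<Longrightarrow> 0 \<le> w r \<and> w r \<le> 2 * int r - 1"
    and q: "\<And>r. q r > 0"
    and f: "\<And>r. r \<ge> 1 \<Longrightarrow> \<bar>f r\<bar> \<le> 156 * real r ^ 3 / 4 ^ r"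
    and f_eq: "\<And>r. f r = real_of_int (p r) / real_of_int (q r)"
    and v: "(\<Sum>r\<leftarrow>[1..<61]. w r * ((10 ^ 28 * p r) div q r)) = v"
  shows "real_of_int v / 10 ^ 28 - 1 / 10 ^ 24 \<le> (\<Sum>\<^sub>\<infinity>r\<in>{1..}. real_of_int (w r) * f r)"
    and "(\<Sum>\<^sub>\<infinity>r\<in>{1..}. real_of_int (w r) * f r) \<le> real_of_int v / 10 ^ 28 + 1 / 10 ^ 24"
proof -
  \<comment> \<open>The bound 2 r - 1 admits both weights in use, and the first 60 odd numbers sum
    to 60^2 = 3600.\<close>
  have "sum w {1..60} \<le> (\<Sum>r=1..60. 2 * int r - 1)"
    using w by (intro sum_mono) auto
  also have "\<dots> = 3600"
    unfolding sum_1_60 by code_simp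
  finally have "real_of_int (sum w {1..60}) \<le> 3600" by linarith
  moreover have "\<bar>(\<Sum>\<^sub>\<infinity>r\<in>{1..}. real_of_int (w r) * f r) - (\<Sum>r=1..60. real_of_int (w r) * f r)\<bar> \<le> 1 / 10 ^ 26"
  proof (rule truncation_error[OF _ f])
    fix r :: nat assume "r \<ge> 1"
    then have "\<bar>w r\<bar> \<le> 2 * int r" using w[of r] by auto
    then have "real_of_int \<bar>w r\<bar> \<le> real_of_int (2 * int r)" by (simp only: of_int_le_iff)
    then show "\<bar>real_of_int (w r)\<bar> \<le> 2 * real r" by simp
  qed
  moreover have "real_of_int v / 10 ^ 28 \<le> (\<Sum>r=1..60. real_of_int (w r) * f r)"
    "(\<Sum>r=1..60. real_of_int (w r) * f r) \<le> (real_of_int v + real_of_int (sum w {1..60})) / 10 ^ 28"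
    using fixed_point_sum_bounds[of "10 ^ 28" "{1..60}" w q p] w q
    unfolding sum_1_60 v f_eq by auto
  moreover have "V / 10 ^ 28 - 1 / 10 ^ 24 \<le> I \<and> I \<le> V / 10 ^ 28 + 1 / 10 ^ 24"
    if "W \<le> 3600" "\<bar>I - P\<bar> \<le> 1 / 10 ^ 26" "V / 10 ^ 28 \<le> P" "P \<le> (V + W) / 10 ^ 28" for I P V W :: real
    using that(1,3,4) abs_le_D1[OF that(2)] abs_le_D2[OF that(2)] by (simp add: field_simps)
  ultimately show "real_of_int v / 10 ^ 28 - 1 / 10 ^ 24 \<le> (\<Sum>\<^sub>\<infinity>r\<in>{1..}. real_of_int (w r) * f r)"
    and "(\<Sum>\<^sub>\<infinity>r\<in>{1..}. real_of_int (w r) * f r) \<le> real_of_int v / 10 ^ 28 + 1 / 10 ^ 24"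
    by blast+
qed

lemma constants:
  "c0 \<in> {2.71825364286795285266 ..< 2.71825364286795285267}"
  "- c1 \<in> {4.22209715101588408238 ..< 4.22209715101588408239}"
  "c2 \<in> {0.91845604214374797357 ..< 0.91845604214374797358}"
  "- c3 \<in> {9.16217532008362749969 ..< 9.16217532008362749970}"
proof -
  have pos: "(4 ^ r + 2) ^ k > (0 :: int)" for r k :: nat
    by (intro zero_less_power add_pos_pos) auto
  note lead = infsum_fixed_point_bounds[OF _ pos coeff_bounds(1) age_lead_eq]
  note second = infsum_fixed_point_bounds[OF _ pos coeff_bounds(2) age_second_eq]
  define X where "X = (\<Sum>\<^sub>\<infinity>r\<in>{1..}. age_second r)"
  define A where "A = (\<Sum>\<^sub>\<infinity>r\<in>{1..}. (2 * real r - 1) * age_lead r)"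
  define B where "B = (\<Sum>\<^sub>\<infinity>r\<in>{1..}. (2 * real r - 1) * age_second r)"
  \<comment> \<open>These are the floor sums scaled by 10^-28, widened by 10^-24 and rounded outward
    to 24 decimals. The digits beyond the required 20 absorb the error growth in c0^2 and 2 c0
    c1.\<close>
  define lo hi lo' hi' :: real
    where "lo = 2.718253642867952852664835" and "hi = 2.718253642867952852664838"
      and "lo' = 4.222097151015884082382186" and "hi' = 4.222097151015884082382189"
  have "0 \<le> lo" "0 \<le> lo'" by (simp_all add: lo_def lo'_def)
  have c0: "lo \<le> c0" "c0 \<le> hi"
    using lead[OF _ _ lead_floor_sum] by (auto simp: c_eqs(1) lo_def hi_def)
  have X: "lo' \<le> X" "X \<le> hi'"
    using second[OF _ _ second_floor_sum] by (auto simp: X_def lo'_def hi'_def)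
  have A: "8.3073589091086441440122 \<le> A" "A \<le> 8.3073589091086441440124"
    using lead[OF _ _ weighted_lead_floor_sum] by (auto simp: A_def)
  have B: "32.115637242666291846166288 \<le> B" "B \<le> 32.115637242666291846166291"
    using second[OF _ _ weighted_second_floor_sum] by (auto simp: B_def)
  show "c0 \<in> {2.71825364286795285266 ..< 2.71825364286795285267}"
    using c0 by (auto simp: lo_def hi_def)
  show "- c1 \<in> {4.22209715101588408238 ..< 4.22209715101588408239}"
  proof -
    have "- c1 = X" by (simp add: c_eqs(2) X_def)
    then show ?thesis using X by (auto simp: lo'_def hi'_def)
  qed
  have "lo\<^sup>2 \<le> c0\<^sup>2" "c0\<^sup>2 \<le> hi\<^sup>2"
    using c0 \<open>0 \<le> lo\<close> by (auto intro!: power_mono)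
  moreover have "c2 = A - c0\<^sup>2" by (simp add: c_eqs(3) A_def)
  ultimately show "c2 \<in> {0.91845604214374797357 ..< 0.91845604214374797358}"
    using A by (auto simp: lo_def hi_def power2_eq_square)
  have "lo * lo' \<le> c0 * X" "c0 * X \<le> hi * hi'"
    using c0 X \<open>0 \<le> lo\<close> \<open>0 \<le> lo'\<close> by (intro mult_mono; linarith)+
  moreover have "- c3 = B - 2 * (c0 * X)" by (simp add: c_eqs(4,2) B_def X_def)
  ultimately show "- c3 \<in> {9.16217532008362749969 ..< 9.16217532008362749970}"
    using B by (auto simp: lo_def hi_def lo'_def hi'_def)
qed

subsection \<open>The limit law and its moments\<close>

theorem mainTheorem8:
  shows
    "(\<exists>C. \<forall>\<^sub>F n in sequentially. \<forall>r\<ge>1.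
        \<bar>measure_pmf.prob (random_cs_tree n) {t. age t = r}
         - ((4 * (4 ^ r * (3 * real r - 1) + 1) / (4 ^ r + 2) ^ 2
             - 4 * (4 ^ (r + 1) * (3 * real r + 2) + 1) / (4 ^ (r + 1) + 2) ^ 2)
            - ((6 * 64 ^ r * (2 * real r ^ 3 - 5 * real r ^ 2 + 4 * real r - 1)
                - 6 * 16 ^ r * (16 * real r ^ 3 - 24 * real r ^ 2 + 10 * real r - 1)
                + 24 * 4 ^ r * (2 * real r ^ 3 - real r ^ 2)) / (4 ^ r + 2) ^ 4
               - (6 * 64 ^ (r + 1) * (2 * real r ^ 3 + real r ^ 2)
                  - 6 * 16 ^ (r + 1) * (16 * real r ^ 3 + 24 * real r ^ 2 + 10 * real r + 1)
                  + 24 * 4 ^ (r + 1) * (2 * real r ^ 3 + 5 * real r ^ 2 + 4 * real r + 1))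
                 / (4 ^ (r + 1) + 2) ^ 4) / real n)\<bar>
        \<le> C * (real r ^ 5 / 3 ^ r / real n ^ 2))
     \<and> c0 \<in> {2.71825364286795285266 ..< 2.71825364286795285267}
     \<and> - c1 \<in> {4.22209715101588408238 ..< 4.22209715101588408239}
     \<and> c2 \<in> {0.91845604214374797357 ..< 0.91845604214374797358}
     \<and> - c3 \<in> {9.16217532008362749969 ..< 9.16217532008362749970}
     \<and> (\<lambda>n. measure_pmf.expectation (random_cs_tree n) (\<lambda>t. real (age t))
            - (c0 + c1 / real n)) \<in> O(\<lambda>n. 1 / real n ^ 2)
     \<and> (\<lambda>n. measure_pmf.variance (random_cs_tree n) (\<lambda>t. real (age t))
            - (c2 + c3 / real n)) \<in> O(\<lambda>n. 1 / real n ^ 2)"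
proof -
  obtain C where C: "\<And>n r. n \<ge> 3 \<Longrightarrow> r \<ge> 1 \<Longrightarrow>
    \<bar>measure_pmf.prob (random_cs_tree n) {t. age t = r} -
      ((age_lead r - age_lead (r + 1)) - (age_second r - age_second (r + 1)) / real n)\<bar>
    \<le> C * (real r ^ 5 / 3 ^ r / real n ^ 2)"
    using age_distribution_expansion by blast
  have lead: "4 * (4 ^ r * (3 * real r - 1) + 1) / (4 ^ r + 2) ^ 2 = age_lead r"
    "4 * (4 ^ (r + 1) * (3 * real r + 2) + 1) / (4 ^ (r + 1) + 2) ^ 2 = age_lead (r + 1)" for r
    by (simp_all add: age_lead_def algebra_simps)
  have second: "(6 * 64 ^ r * (2 * real r ^ 3 - 5 * real r ^ 2 + 4 * real r - 1)
      - 6 * 16 ^ r * (16 * real r ^ 3 - 24 * real r ^ 2 + 10 * real r - 1)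
      + 24 * 4 ^ r * (2 * real r ^ 3 - real r ^ 2)) / (4 ^ r + 2) ^ 4 = age_second r" for r
    unfolding age_second_def
    by (rule arg_cong2[where f = "(/)"]) (simp_all add: algebra_simps power2_eq_square power3_eq_cube)
  \<comment> \<open>The polynomials displayed next to the powers with exponent r + 1 are the
    expanded shifts of those in \<open>age_second\<close>.\<close>
  have poly: "2 * (x + 1) ^ 3 - 5 * (x + 1) ^ 2 + 4 * (x + 1) - 1 = 2 * x ^ 3 + x ^ 2"
    "16 * (x + 1) ^ 3 - 24 * (x + 1) ^ 2 + 10 * (x + 1) - 1 = 16 * x ^ 3 + 24 * x ^ 2 + 10 * x + 1"
    "2 * (x + 1) ^ 3 - (x + 1) ^ 2 = 2 * x ^ 3 + 5 * x ^ 2 + 4 * x + 1" for x :: real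
    by (simp_all add: algebra_simps power2_eq_square power3_eq_cube)
  have second_Suc: "(6 * 64 ^ (r + 1) * (2 * real r ^ 3 + real r ^ 2)
      - 6 * 16 ^ (r + 1) * (16 * real r ^ 3 + 24 * real r ^ 2 + 10 * real r + 1)
      + 24 * 4 ^ (r + 1) * (2 * real r ^ 3 + 5 * real r ^ 2 + 4 * real r + 1)) / (4 ^ (r + 1) + 2) ^ 4
      = age_second (r + 1)" for r
    using second[of "r + 1"] unfolding of_nat_add of_nat_1 poly .
  obtain K where K: "\<And>n. n \<ge> 3 \<Longrightarrow>
    \<bar>measure_pmf.expectation (random_cs_tree n) (\<lambda>t. real (age t)) - (c0 + c1 / real n)\<bar> \<le> K / real n ^ 2"
    using expectation_age_expansion by blast
  obtain K' where K': "\<And>n. n \<ge> 3 \<Longrightarrow>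
    \<bar>measure_pmf.variance (random_cs_tree n) (\<lambda>t. real (age t)) - (c2 + c3 / real n)\<bar> \<le> K' / real n ^ 2"
    using variance_age_expansion by blast
  show ?thesis
    unfolding lead second second_Suc
  proof (intro conjI exI)
    show "\<forall>\<^sub>F n in sequentially. \<forall>r\<ge>1. \<bar>measure_pmf.prob (random_cs_tree n) {t. age t = r} -
      ((age_lead r - age_lead (r + 1)) - (age_second r - age_second (r + 1)) / real n)\<bar>
      \<le> C * (real r ^ 5 / 3 ^ r / real n ^ 2)"
      using eventually_ge_at_top[of 3] by eventually_elim (intro allI impI C)
  qed (fact constants | (rule bigo_inverse_squareI, erule K K'))+
qed

end
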